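(* There exist absolute constants $c,C>0$ such that the following holds. Let $n\ge1$, $\eta\in(0,1)$, and $(a,b)\in\mathcal S_\eta$ with $b$ a polynomial of degree at most $n-1$ and $a^*$ an outer polynomial; let $\boldsymbol\gamma=(\gamma_0,\dots,\gamma_{n-1})^T$ be the inverse NLFT of $(a,b)$. Suppose the layer stripping algorithm (see context) is run in floating-point arithmetic with machine precision $\epsilon_{\mathrm{ma}}$ on the exact input coefficients, producing $\hat{\boldsymbol\gamma}$. If $n^3\eta^{-5/2}\epsilon_{\mathrm{ma}}\le c$, then $$\frac{\|\hat{\boldsymbol\gamma}-\boldsymbol\gamma\|_2}{\|\boldsymbol\gamma\|_2}\le C\,n^3\eta^{-5/2}\epsilon_{\mathrm{ma}}.$$ In particular, a target relative precision $\epsilon$ is achieved with $\mathcal O(\log(n\eta^{-1}\epsilon^{-1}))$ bits of precision.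
   Context: For a Laurent polynomial $a$, $a^*(z):=\overline{a(1/\overline z)}$. $\mathcal S$ is the set of pairs $(a,b)$ of Laurent polynomials with $aa^*+bb^*=1$ and $0<a^*(0)<\infty$; the NLFT, $\boldsymbol\gamma\mapsto(a,b)$ where $\prod_{k}\frac{1}{\sqrt{1+|\gamma_k|^2}}\begin{pmatrix}1&\gamma_k z^k\\-\overline{\gamma_k}z^{-k}&1\end{pmatrix}=\begin{pmatrix}a&b\\-b^*&a^*\end{pmatrix}$ (product over the support, increasing $k$ left to right), is a bijection from compactly supported sequences onto $\mathcal S$, and its inverse is the inverse NLFT. For $\eta\in(0,1)$, $\mathcal S_\eta:=\{(a,b)\in\mathcal S:b\text{ polynomial},\ 0<\sup_{|z|=1}|b(z)|\le1-\eta\}$. A polynomial is outer if it has no zeros in the open unit disk. Layer stripping algorithm: input the coefficient vectors $\mathbf a_0=(a_{j,0})_{j=0}^{n-1}$ of $a^*$ and $\mathbf b_0=(b_{j,0})_{j=0}^{n-1}$ of $b$; for $k=0,\dots,n-1$: output $\gamma_k=b_{0,k}/a_{0,k}$, then compute the $(n-k)\times2$ matrix $(\mathbf a_k,\mathbf b_k)\,\frac{1}{\sqrt{1+|\gamma_k|^2}}\begin{pmatrix}1&-\gamma_k\\\overline{\gamma_k}&1\end{pmatrix}$, and form $\mathbf a_{k+1}$ as its first column with the last entry removed and $\mathbf b_{k+1}$ as its second column with the first entry removed (each of length $n-k-1$). In exact arithmetic this outputs the inverse NLFT $\boldsymbol\gamma$. Floating-point model: every elementary arithmetic operation (including division and square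 root) returns the exact result times $(1+\delta)$ with $|\delta|\le\epsilon_{\mathrm{ma}}$. *)

theory Defs
  imports "HOL-Analysis.Analysis"
begin

type_synonym lpoly = "int \<Rightarrow> complex"

definition is_lpoly :: "lpoly \<Rightarrow> bool" where
  "is_lpoly p \<longleftrightarrow> finite {k. p k \<noteq> 0}"

definition lconst :: "complex \<Rightarrow> lpoly" where
  "lconst c = (\<lambda>k. if k = 0 then c else 0)"

definition lmono :: "complex \<Rightarrow> int \<Rightarrow> lpoly" where
  "lmono c m = (\<lambda>k. if k = m then c else 0)"

definition ladd :: "lpoly \<Rightarrow> lpoly \<Rightarrow> lpoly" where
  "ladd p q = (\<lambda>k. p k + q k)"

definition lmult :: "lpoly \<Rightarrow> lpoly \<Rightarrow> lpoly" where
  "lmult p q = (\<lambda>k. \<Sum>j\<in>{j. p j \<noteq> 0}. p j * q (k - j))"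

text \<open>\<open>a\<^sup>*(z) = conj (a (1 / conj z))\<close>: on coefficients, \<open>(a\<^sup>*)_k = conj (a_{-k})\<close>.\<close>
definition lstar :: "lpoly \<Rightarrow> lpoly" where
  "lstar p = (\<lambda>k. cnj (p (- k)))"

text \<open>Evaluation at a nonzero point (or at 0 for genuine polynomials).\<close>
definition leval :: "lpoly \<Rightarrow> complex \<Rightarrow> complex" where
  "leval p z = (\<Sum>k\<in>{k. p k \<noteq> 0}. p k * z powi k)"

definition is_poly :: "lpoly \<Rightarrow> bool" where
  "is_poly p \<longleftrightarrow> is_lpoly p \<and> (\<forall>k<0. p k = 0)"

definition outer_poly :: "lpoly \<Rightarrow> bool" where
  "outer_poly p \<longleftrightarrow> is_poly p \<and> (\<forall>z. cmod z < 1 \<longrightarrow> leval p z \<noteq> 0)"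

text \<open>\<open>0 < a\<^sup>*(0) < \<infinity>\<close>: \<open>a\<^sup>*\<close> has no negative powers and its constant term is a positive real.\<close>
definition S_set :: "(lpoly \<times> lpoly) set" where
  "S_set = {(a, b). is_lpoly a \<and> is_lpoly b \<and>
      ladd (lmult a (lstar a)) (lmult b (lstar b)) = lconst 1 \<and>
      (\<forall>k<0. lstar a k = 0) \<and> lstar a 0 \<in> \<real> \<and> Re (lstar a 0) > 0}"

definition S_eta :: "real \<Rightarrow> (lpoly \<times> lpoly) set" where
  "S_eta \<eta> = {(a, b). (a, b) \<in> S_set \<and> is_poly b \<and>
      0 < Sup ((\<lambda>z. cmod (leval b z)) ` sphere 0 1) \<and>
      Sup ((\<lambda>z. cmod (leval b z)) ` sphere 0 1) \<le> 1 - \<eta>}"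

type_synonym lmat = "lpoly \<times> lpoly \<times> lpoly \<times> lpoly"  \<comment> \<open>entries (1,1),(1,2),(2,1),(2,2)\<close>

definition mmul :: "lmat \<Rightarrow> lmat \<Rightarrow> lmat" where
  "mmul M N = (case M of (p11, p12, p21, p22) \<Rightarrow> case N of (q11, q12, q21, q22) \<Rightarrow>
     (ladd (lmult p11 q11) (lmult p12 q21), ladd (lmult p11 q12) (lmult p12 q22),
      ladd (lmult p21 q11) (lmult p22 q21), ladd (lmult p21 q12) (lmult p22 q22)))"

definition mid :: lmat where
  "mid = (lconst 1, lconst 0, lconst 0, lconst 1)"

definition nlft_factor :: "complex \<Rightarrow> int \<Rightarrow> lmat" where
  "nlft_factor g k = (let s = complex_of_real (1 / sqrt (1 + (cmod g)\<^sup>2)) in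
     (lconst s, lmono (s * g) k, lmono (- s * cnj g) (- k), lconst s))"

definition nlft_mat :: "(int \<Rightarrow> complex) \<Rightarrow> lmat" where
  "nlft_mat \<gamma> = foldr (\<lambda>k M. mmul (nlft_factor (\<gamma> k) k) M)
                    (sorted_list_of_set {k. \<gamma> k \<noteq> 0}) mid"

definition nlft :: "(int \<Rightarrow> complex) \<Rightarrow> lpoly \<times> lpoly" where
  "nlft \<gamma> = (case nlft_mat \<gamma> of (p11, p12, _, _) \<Rightarrow> (p11, p12))"

text \<open>Floating-point model: each elementary operation returns the exact result times
  \<open>1 + \<delta>\<close>; the perturbations are supplied by \<open>d k j i\<close> (step \<open>k\<close>, row \<open>j\<close>, operation \<open>i\<close>).\<close>
definition fl :: "complex \<Rightarrow> complex \<Rightarrow> complex" where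
  "fl x \<delta> = x * (1 + \<delta>)"

type_synonym perturb = "nat \<Rightarrow> nat \<Rightarrow> nat \<Rightarrow> complex"

definition ls_step :: "perturb \<Rightarrow> nat \<Rightarrow> complex list \<times> complex list
                        \<Rightarrow> complex \<times> complex list \<times> complex list" where
  "ls_step d k st = (case st of (as, bs) \<Rightarrow>
     let g  = fl (bs ! 0 / as ! 0) (d k 0 0);
         t1 = fl (g * cnj g) (d k 0 1);
         t2 = fl (1 + t1) (d k 0 2);
         t3 = fl (csqrt t2) (d k 0 3);
         s  = fl (1 / t3) (d k 0 4);
         a' = (\<lambda>j. fl (s * fl (as ! j + fl (cnj g * bs ! j) (d k (Suc j) 0)) (d k (Suc j) 1))
                     (d k (Suc j) 2));
         b' = (\<lambda>j. fl (s * fl (bs ! j - fl (g * as ! j) (d k (Suc j) 3)) (d k (Suc j) 4))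
                     (d k (Suc j) 5));
         m  = length as
     in (g, butlast (map a' [0..<m]), tl (map b' [0..<m])))"

fun ls_run :: "perturb \<Rightarrow> nat \<Rightarrow> nat \<Rightarrow> complex list \<times> complex list \<Rightarrow> complex list" where
  "ls_run d k 0 st = []"
| "ls_run d k (Suc m) st =
     (case ls_step d k st of (g, as', bs') \<Rightarrow> g # ls_run d (Suc k) m (as', bs'))"

definition layer_strip_fl :: "perturb \<Rightarrow> nat \<Rightarrow> lpoly \<Rightarrow> lpoly \<Rightarrow> complex list" where
  "layer_strip_fl d n a b =
     ls_run d 0 n (map (\<lambda>j. lstar a (int j)) [0..<n], map (\<lambda>j. b (int j)) [0..<n])"

definition ext_seq :: "complex list \<Rightarrow> int \<Rightarrow> complex" where
  "ext_seq xs k = (if 0 \<le> k \<and> nat k < length xs then xs ! nat k else 0)"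

definition l2norm :: "(int \<Rightarrow> complex) \<Rightarrow> real" where
  "l2norm f = sqrt (\<Sum>k\<in>{k. f k \<noteq> 0}. (cmod (f k))\<^sup>2)"

end

theory Submission
  imports Defs "HOL-Complex_Analysis.Complex_Analysis"
begin

text \<open>Write \<open>T(p)\<close> for the lower triangular Toeplitz matrix of \<open>p\<close>. Layer stripping is the generalized Schur
  algorithm: it computes the columns of the Cholesky factor of \<open>K = T(a\<^sup>*) T(a\<^sup>*)\<^sup>H + T(b) T(b)\<^sup>H\<close>, whose
  displacement has the generator \<open>(a\<^sup>*, b)\<close>. Since every step is a unitary rotation, rounding errors perturb \<open>K\<close>
  by only \<open>O(n\<^sup>2 \<epsilon>)\<close>. Outerness of \<open>a\<^sup>*\<close> and \<open>|a|\<^sup>2 \<ge> \<eta>\<close> on the circle give \<open>K \<ge> \<eta>\<close>. Finally \<open>\<gamma>\<^sub>k\<close> equals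
  \<open>\<langle>u\<^sub>k, b\<rangle> / a\<^sup>*(0)\<close>, where \<open>u\<^sub>k\<close> is supported on \<open>{0..k}\<close>, has last entry 1 and minimises \<open>\<langle>u, K u\<rangle>\<close>; such a
  minimiser is stable under perturbation of \<open>K\<close>.\<close>

section \<open>Finite vectors and their shifts\<close>

text \<open>The obstacle is that the error is measured relative to \<gamma>, which may be
  arbitrarily small although the pair (a*, b) always has norm 1. An absolute perturbation of K is
  harmless, but whatever is added to b must be proportional to the coefficients. Two kinds of
  estimates are therefore kept apart: the Gram form is controlled by the norm of the pair, the
  expansion of b in the computed columns by \<open>vnorm n (B 0)\<close> and the sum of the
  |\<gamma>_k|. The computed coefficients on the right-hand side are absorbed at the very end.
  Powers of \<eta>: the size of u_k costs \<eta>^(-1/2), its perturbation a further \<eta>^(-1), and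
  the division by a*(0) another \<eta>^(-1/2). The result is \<eta>^(-2), which implies the claim.
  Powers of n: n^2 from n steps seen through n shifts, and two factors sqrt n from comparing sup, l1
  and l2 norms. The exact and the floating-point run are instances of one inexact recursion, with
  error levels 0 and 20 \<epsilon>, so that the same dual vectors are available for both.\<close>

definition vnorm :: "nat \<Rightarrow> (nat \<Rightarrow> complex) \<Rightarrow> real" where
  "vnorm n x = L2_set (\<lambda>i. cmod (x i)) {..<n}"

definition vinner :: "nat \<Rightarrow> (nat \<Rightarrow> complex) \<Rightarrow> (nat \<Rightarrow> complex) \<Rightarrow> complex" where
  "vinner n x y = (\<Sum>i<n. cnj (x i) * y i)"

lemma vnorm_nonneg [simp]: "0 \<le> vnorm n x"
  by (simp add: vnorm_def)

lemma vnorm_cong: "(\<And>i. i < n \<Longrightarrow> x i = y i) \<Longrightarrow> vnorm n x = vnorm n y"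
  unfolding vnorm_def by (intro L2_set_cong) auto

lemma vinner_cong:
  "(\<And>i. i < n \<Longrightarrow> x i = x' i) \<Longrightarrow> (\<And>i. i < n \<Longrightarrow> y i = y' i) \<Longrightarrow> vinner n x y = vinner n x' y'"
  unfolding vinner_def by (intro sum.cong) auto

lemma vnorm_sq: "(vnorm n x)\<^sup>2 = (\<Sum>i<n. (cmod (x i))\<^sup>2)"
  unfolding vnorm_def L2_set_def by (simp add: sum_nonneg)

lemma norm_le_vnorm: "i < n \<Longrightarrow> cmod (x i) \<le> vnorm n x"
  unfolding vnorm_def using member_le_L2_set[of "{..<n}" i "\<lambda>i. cmod (x i)"] by simp

lemma vnorm_zero [simp]: "vnorm n (\<lambda>i. 0) = 0"
  by (simp add: vnorm_def L2_set_def)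

lemma vnorm_add: "vnorm n (\<lambda>i. x i + y i) \<le> vnorm n x + vnorm n y"
proof -
  have "vnorm n (\<lambda>i. x i + y i) \<le> L2_set (\<lambda>i. cmod (x i) + cmod (y i)) {..<n}"
    unfolding vnorm_def by (intro L2_set_mono norm_triangle_ineq) auto
  also have "\<dots> \<le> vnorm n x + vnorm n y"
    unfolding vnorm_def by (rule L2_set_triangle_ineq)
  finally show ?thesis .
qed

lemma vnorm_scale: "vnorm n (\<lambda>i. c * x i) = cmod c * vnorm n x"
  unfolding vnorm_def by (simp add: norm_mult L2_set_right_distrib)

lemma vnorm_sum_le:
  assumes "finite S"
  shows "vnorm n (\<lambda>i. \<Sum>k\<in>S. c k * x k i) \<le> (\<Sum>k\<in>S. cmod (c k) * vnorm n (x k))"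
  using assms
proof (induction S rule: finite_induct)
  case (insert k S)
  have "vnorm n (\<lambda>i. \<Sum>k\<in>insert k S. c k * x k i)
      = vnorm n (\<lambda>i. c k * x k i + (\<Sum>k\<in>S. c k * x k i))"
    using insert by simp
  also have "\<dots> \<le> vnorm n (\<lambda>i. c k * x k i) + vnorm n (\<lambda>i. \<Sum>k\<in>S. c k * x k i)"
    by (rule vnorm_add)
  also have "\<dots> \<le> (\<Sum>k\<in>insert k S. cmod (c k) * vnorm n (x k))"
    using insert by (simp add: vnorm_scale)
  finally show ?case .
qed simp

lemma vnorm_le_comb:
  assumes "\<And>i. i < n \<Longrightarrow> cmod (z i) \<le> r * cmod (x i) + s * cmod (y i)" "0 \<le> r" "0 \<le> s"
  shows "vnorm n z \<le> r * vnorm n x + s * vnorm n y"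
proof -
  have "vnorm n z \<le> L2_set (\<lambda>i. r * cmod (x i) + s * cmod (y i)) {..<n}"
    unfolding vnorm_def using assms(1) by (intro L2_set_mono) auto
  also have "\<dots> \<le> L2_set (\<lambda>i. r * cmod (x i)) {..<n} + L2_set (\<lambda>i. s * cmod (y i)) {..<n}"
    by (rule L2_set_triangle_ineq)
  also have "\<dots> = r * vnorm n x + s * vnorm n y"
    unfolding vnorm_def using assms by (simp add: L2_set_right_distrib)
  finally show ?thesis .
qed

lemma vinner_bound: "cmod (vinner n x y) \<le> vnorm n x * vnorm n y"
proof -
  have "cmod (vinner n x y) \<le> (\<Sum>i<n. \<bar>cmod (x i)\<bar> * \<bar>cmod (y i)\<bar>)"
    unfolding vinner_def by (rule sum_norm_le) (simp add: norm_mult)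
  also have "\<dots> \<le> vnorm n x * vnorm n y"
    unfolding vnorm_def by (rule L2_set_mult_ineq)
  finally show ?thesis .
qed

lemma vinner_add_right: "vinner n x (\<lambda>i. y i + z i) = vinner n x y + vinner n x z"
  by (simp add: vinner_def distrib_left sum.distrib)

lemma vinner_add_left: "vinner n (\<lambda>i. x i + y i) z = vinner n x z + vinner n y z"
  by (simp add: vinner_def distrib_right sum.distrib)

lemma vinner_diff_left: "vinner n (\<lambda>i. x i - y i) z = vinner n x z - vinner n y z"
  by (simp add: vinner_def left_diff_distrib sum_subtractf)

lemma vinner_scale_right: "vinner n x (\<lambda>i. c * y i) = c * vinner n x y"
  by (simp add: vinner_def sum_distrib_left mult_ac)

lemma vinner_sum_right: "vinner n x (\<lambda>i. \<Sum>k\<in>S. c k * y k i) = (\<Sum>k\<in>S. c k * vinner n x (y k))"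
proof -
  have "vinner n x (\<lambda>i. \<Sum>k\<in>S. c k * y k i) = (\<Sum>i<n. \<Sum>k\<in>S. cnj (x i) * (c k * y k i))"
    by (simp add: vinner_def sum_distrib_left)
  also have "\<dots> = (\<Sum>k\<in>S. \<Sum>i<n. cnj (x i) * (c k * y k i))"
    by (rule sum.swap)
  finally show ?thesis
    by (simp add: vinner_def sum_distrib_left mult_ac)
qed

lemma vinner_commute: "vinner n y x = cnj (vinner n x y)"
  by (simp add: vinner_def mult_ac)

lemma vinner_self: "vinner n x x = complex_of_real ((vnorm n x)\<^sup>2)"
  unfolding vnorm_sq vinner_def of_real_sum complex_norm_square
  by (simp add: mult.commute)

section \<open>Rank-one forms v v^H and their invariance under rotations\<close>

definition outer_form :: "nat \<Rightarrow> (nat \<Rightarrow> complex) \<Rightarrow> (nat \<Rightarrow> complex) \<Rightarrow> (nat \<Rightarrow> complex) \<Rightarrow> complex" where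
  "outer_form n v x y = vinner n x v * vinner n v y"

lemma outer_form_self: "outer_form n v x x = complex_of_real ((cmod (vinner n v x))\<^sup>2)"
proof -
  have "outer_form n v x x = cnj (vinner n v x) * vinner n v x"
    by (simp add: outer_form_def vinner_commute[of n x v])
  then show ?thesis
    unfolding complex_norm_square by (simp add: mult.commute)
qed

lemma outer_form_add_bound:
  "cmod (outer_form n (\<lambda>i. v i + w i) x y - outer_form n v x y)
     \<le> (2 * vnorm n v * vnorm n w + (vnorm n w)\<^sup>2) * (vnorm n x * vnorm n y)"
proof -
  have m: "cmod (vinner n x p) * cmod (vinner n q y) \<le> (vnorm n x * vnorm n p) * (vnorm n q * vnorm n y)"
    for p q by (rule mult_mono[OF vinner_bound vinner_bound]) simp_all
  have "outer_form n (\<lambda>i. v i + w i) x y - outer_form n v x y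
      = vinner n x v * vinner n w y + vinner n x w * vinner n v y + vinner n x w * vinner n w y"
    by (simp add: outer_form_def vinner_add_left vinner_add_right algebra_simps)
  then have "cmod (outer_form n (\<lambda>i. v i + w i) x y - outer_form n v x y)
      \<le> cmod (vinner n x v * vinner n w y) + cmod (vinner n x w * vinner n v y)
        + cmod (vinner n x w * vinner n w y)"
    by (simp only: norm_triangle_le norm_triangle_ineq add_right_mono)
  also have "\<dots> \<le> (vnorm n x * vnorm n v) * (vnorm n w * vnorm n y)
      + (vnorm n x * vnorm n w) * (vnorm n v * vnorm n y)
      + (vnorm n x * vnorm n w) * (vnorm n w * vnorm n y)"
    unfolding norm_mult by (intro add_mono m)
  also have "\<dots> = (2 * vnorm n v * vnorm n w + (vnorm n w)\<^sup>2) * (vnorm n x * vnorm n y)"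
    by (simp add: algebra_simps power2_eq_square)
  finally show ?thesis .
qed

text \<open>The hypothesis makes the 2x2 matrix of the rotation unitary, so multiplying the pair (a,
  b) by it from the right preserves a a^H + b b^H. This is the invariant on which layer stripping
  rests.\<close>

lemma outer_form_rotate:
  fixes \<sigma> :: real and g :: complex and a b :: "nat \<Rightarrow> complex"
  assumes \<sigma>: "\<sigma>\<^sup>2 * (1 + (cmod g)\<^sup>2) = 1"
  shows "outer_form n (\<lambda>i. \<sigma> * (a i + cnj g * b i)) x y + outer_form n (\<lambda>i. \<sigma> * (b i - g * a i)) x y
       = outer_form n a x y + outer_form n b x y"
proof -
  define xa where "xa = vinner n x a"
  define xb where "xb = vinner n x b"
  define ya where "ya = vinner n a y"
  define yb where "yb = vinner n b y"
  have 1: "vinner n x (\<lambda>i. \<sigma> * (a i + cnj g * b i)) = \<sigma> * (xa + cnj g * xb)"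
    unfolding xa_def xb_def by (simp only: vinner_scale_right vinner_add_right)
  have 2: "vinner n x (\<lambda>i. \<sigma> * (b i - g * a i)) = \<sigma> * (xb - g * xa)"
    unfolding xa_def xb_def by (simp add: vinner_def sum_distrib_left sum_subtractf algebra_simps)
  have 3: "vinner n (\<lambda>i. \<sigma> * (a i + cnj g * b i)) y = \<sigma> * (ya + g * yb)"
    unfolding ya_def yb_def by (simp add: vinner_def sum_distrib_left sum.distrib algebra_simps)
  have 4: "vinner n (\<lambda>i. \<sigma> * (b i - g * a i)) y = \<sigma> * (yb - cnj g * ya)"
    unfolding ya_def yb_def by (simp add: vinner_def sum_distrib_left sum_subtractf algebra_simps)
  have s: "complex_of_real \<sigma> * \<sigma> * (1 + g * cnj g) = 1"
    using arg_cong[OF \<sigma>, of complex_of_real]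
    unfolding of_real_mult of_real_add complex_norm_square by (simp add: power2_eq_square)
  have "outer_form n (\<lambda>i. \<sigma> * (a i + cnj g * b i)) x y + outer_form n (\<lambda>i. \<sigma> * (b i - g * a i)) x y
      = (complex_of_real \<sigma> * \<sigma> * (1 + g * cnj g)) * (xa * ya + xb * yb)"
    unfolding outer_form_def 1 2 3 4 by (simp add: algebra_simps)
  also have "\<dots> = outer_form n a x y + outer_form n b x y"
    unfolding s by (simp add: outer_form_def xa_def xb_def ya_def yb_def)
  finally show ?thesis .
qed

text \<open>The trace of the same invariance, checked entry by entry.\<close>

lemma vnorm_rotate:
  fixes \<sigma> :: real and g :: complex and a b :: "nat \<Rightarrow> complex"
  assumes \<sigma>: "\<sigma>\<^sup>2 * (1 + (cmod g)\<^sup>2) = 1"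
  shows "(vnorm n (\<lambda>i. \<sigma> * (a i + cnj g * b i)))\<^sup>2 + (vnorm n (\<lambda>i. \<sigma> * (b i - g * a i)))\<^sup>2
       = (vnorm n a)\<^sup>2 + (vnorm n b)\<^sup>2"
proof -
  have pt: "(cmod (\<sigma> * (u + cnj g * v)))\<^sup>2 + (cmod (\<sigma> * (v - g * u)))\<^sup>2 = (cmod u)\<^sup>2 + (cmod v)\<^sup>2" for u v :: complex
  proof -
    have "(cmod (u + cnj g * v))\<^sup>2 + (cmod (v - g * u))\<^sup>2 = (1 + (cmod g)\<^sup>2) * ((cmod u)\<^sup>2 + (cmod v)\<^sup>2)"
      by (simp only: cmod_power2 complex_add_cnj) (simp add: algebra_simps power2_eq_square)
    then have "\<sigma>\<^sup>2 * ((cmod (u + cnj g * v))\<^sup>2 + (cmod (v - g * u))\<^sup>2)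
       = (\<sigma>\<^sup>2 * (1 + (cmod g)\<^sup>2)) * ((cmod u)\<^sup>2 + (cmod v)\<^sup>2)" by simp
    then show ?thesis unfolding \<sigma> norm_mult power_mult_distrib by (simp add: distrib_left)
  qed
  show ?thesis unfolding vnorm_sq sum.distrib[symmetric] using pt by (intro sum.cong) auto
qed

section \<open>The nilpotent shift and its adjoint\<close>

definition shift_down :: "nat \<Rightarrow> (nat \<Rightarrow> complex) \<Rightarrow> nat \<Rightarrow> complex" where
  "shift_down j v i = (if i < j then 0 else v (i - j))"

definition shift_up :: "nat \<Rightarrow> nat \<Rightarrow> (nat \<Rightarrow> complex) \<Rightarrow> nat \<Rightarrow> complex" where
  "shift_up n j x i = (if i + j < n then x (i + j) else 0)"

lemma sum_shift_down:
  fixes k :: "nat \<Rightarrow> nat \<Rightarrow> complex"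
  shows "(\<Sum>i<n. if i < j then 0 else k i (i - j)) = (\<Sum>i<n. if i + j < n then k (i + j) i else 0)"
proof -
  have "(\<Sum>i<n. if i < j then 0 else k i (i - j)) = (\<Sum>i\<in>{j..<n}. k i (i - j))"
    by (rule sum.mono_neutral_cong_right) auto
  also have "\<dots> = (\<Sum>i\<in>{i. i + j < n}. k (i + j) i)"
    by (rule sum.reindex_bij_witness[of _ "\<lambda>i. i + j" "\<lambda>i. i - j"]) auto
  also have "\<dots> = (\<Sum>i<n. if i + j < n then k (i + j) i else 0)"
    by (rule sum.mono_neutral_cong_left) auto
  finally show ?thesis .
qed

lemma vinner_shift_right: "vinner n x (shift_down j v) = vinner n (shift_up n j x) v"
proof -
  have "vinner n x (shift_down j v) = (\<Sum>i<n. if i < j then 0 else cnj (x i) * v (i - j))"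
    by (simp add: vinner_def shift_down_def if_distrib cong: if_cong)
  also have "\<dots> = (\<Sum>i<n. if i + j < n then cnj (x (i + j)) * v i else 0)"
    by (rule sum_shift_down)
  also have "\<dots> = vinner n (shift_up n j x) v"
    unfolding vinner_def by (intro sum.cong) (auto simp: shift_up_def)
  finally show ?thesis .
qed

lemma vinner_shift_left: "vinner n (shift_down j v) x = vinner n v (shift_up n j x)"
  by (metis vinner_commute vinner_shift_right)

lemma outer_form_shift:
  "outer_form n (shift_down j v) x y = outer_form n v (shift_up n j x) (shift_up n j y)"
  by (simp add: outer_form_def vinner_shift_right vinner_shift_left)

lemma vnorm_shift_up: "vnorm n (shift_up n j x) \<le> vnorm n x"
proof (rule power2_le_imp_le)
  have "(vnorm n (shift_up n j x))\<^sup>2 = (\<Sum>i\<in>{i. i + j < n}. (cmod (x (i + j)))\<^sup>2)"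
    unfolding vnorm_sq by (rule sum.mono_neutral_cong_right) (auto simp: shift_up_def)
  also have "\<dots> = (\<Sum>i\<in>{j..<n}. (cmod (x i))\<^sup>2)"
    by (rule sum.reindex_bij_witness[of _ "\<lambda>i. i - j" "\<lambda>i. i + j"]) auto
  also have "\<dots> \<le> (vnorm n x)\<^sup>2"
    unfolding vnorm_sq by (rule sum_mono2) auto
  finally show "(vnorm n (shift_up n j x))\<^sup>2 \<le> (vnorm n x)\<^sup>2" .
qed simp

lemma vnorm_shift_down: "vnorm n (shift_down j x) \<le> vnorm n x"
proof (rule power2_le_imp_le)
  have "(vnorm n (shift_down j x))\<^sup>2 = (\<Sum>i\<in>{j..<n}. (cmod (x (i - j)))\<^sup>2)"
    unfolding vnorm_sq by (rule sum.mono_neutral_cong_right) (auto simp: shift_down_def)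
  also have "\<dots> = (\<Sum>i\<in>{i. i + j < n}. (cmod (x i))\<^sup>2)"
    by (rule sum.reindex_bij_witness[of _ "\<lambda>i. i + j" "\<lambda>i. i - j"]) auto
  also have "\<dots> \<le> (vnorm n x)\<^sup>2"
    unfolding vnorm_sq by (rule sum_mono2) auto
  finally show "(vnorm n (shift_down j x))\<^sup>2 \<le> (vnorm n x)\<^sup>2" .
qed simp

lemma shift_up_Suc: "shift_up n (Suc 0) (shift_up n j x) = shift_up n (Suc j) x"
  by (auto simp: shift_up_def fun_eq_iff)

lemma shift_up_0: "i < n \<Longrightarrow> shift_up n 0 x i = x i"
  by (simp add: shift_up_def)

text \<open>Back substitution: \<open>m\<close> counts the conditions met so far, from
  \<open>j = k - 1\<close> downwards. The next correction is a multiple of the unit vector at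
  \<open>p\<close>. By triangularity it does not affect the columns \<open>j > p\<close> already
  treated, and the diagonal entry of column \<open>p\<close> is invertible.\<close>

lemma lower_triangular_dual_basis:
  fixes L :: "nat \<Rightarrow> nat \<Rightarrow> complex"
  assumes k: "k < n" and diag: "\<And>j. j < k \<Longrightarrow> L j j \<noteq> 0"
    and tri: "\<And>j i. i < j \<Longrightarrow> j \<le> k \<Longrightarrow> L j i = 0"
  obtains u where "u k = 1" "\<And>i. k < i \<Longrightarrow> u i = 0" "\<And>j. j < k \<Longrightarrow> vinner n u (L j) = 0"
proof -
  have "\<exists>u. u k = 1 \<and> (\<forall>i>k. u i = 0) \<and> (\<forall>j. k - m \<le> j \<longrightarrow> j < k \<longrightarrow> vinner n u (L j) = 0)"
    if "m \<le> k" for m using that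
  proof (induction m)
    case 0
    show ?case by (rule exI[of _ "\<lambda>i. if i = k then 1 else 0"]) auto
  next
    case (Suc m)
    then obtain u where u: "u k = 1" "\<forall>i>k. u i = 0"
      "\<forall>j. k - m \<le> j \<longrightarrow> j < k \<longrightarrow> vinner n u (L j) = 0" by auto
    define p where "p = k - Suc m"
    have p: "p < k" "p < n" "k - m = Suc p" using Suc k by (auto simp: p_def)
    define c where "c = - vinner n u (L p) / L p p"
    define w where "w = (\<lambda>i. u i + (if i = p then cnj c else 0))"
    have w: "vinner n w (L j) = vinner n u (L j) + c * L j p" for j
      unfolding w_def vinner_add_left using p(2)
      by (simp add: vinner_def if_distrib[of cnj] if_distrib[of "\<lambda>z. z * _"] cong: if_cong)
    have "vinner n w (L j) = 0" if "p \<le> j" "j < k" for j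
    proof (cases "j = p")
      case True
      then show ?thesis using diag[OF p(1)] by (simp add: w c_def)
    next
      case False
      then show ?thesis using that u(3) p tri[of p j] by (simp add: w)
    qed
    then show ?case using u p by (intro exI[of _ w]) (auto simp: w_def p_def)
  qed
  from this[of k] show ?thesis using that by auto
qed

section \<open>Inexact layer stripping as a perturbed Cholesky factorisation\<close>

text \<open>The cosine of the rotation whose tangent has modulus \<open>cmod g\<close>.\<close>

definition rot_scale :: "complex \<Rightarrow> real" where
  "rot_scale g = 1 / sqrt (1 + (cmod g)\<^sup>2)"

lemma rot_scale_pos: "0 < rot_scale g"
  by (simp add: rot_scale_def add_pos_nonneg)

lemma rot_scale_le_1: "rot_scale g \<le> 1"
  by (simp add: rot_scale_def add_pos_nonneg)

lemma rot_scale_sq: "(rot_scale g)\<^sup>2 * (1 + (cmod g)\<^sup>2) = 1"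
proof -
  have "0 < 1 + (cmod g)\<^sup>2" by (simp add: add_pos_nonneg)
  then show ?thesis by (simp add: rot_scale_def power_divide)
qed

text \<open>Cauchy-Schwarz against the unit vector (cosine, sine), with Lagrange's identity
  supplying the missing square.\<close>

lemma rot_scale_comb_le:
  assumes "0 \<le> p" "0 \<le> q"
  shows "rot_scale g * (p + cmod g * q) \<le> sqrt (p\<^sup>2 + q\<^sup>2)"
proof (rule real_le_rsqrt)
  have "(p + cmod g * q)\<^sup>2 + (cmod g * p - q)\<^sup>2 = (1 + (cmod g)\<^sup>2) * (p\<^sup>2 + q\<^sup>2)"
    by (simp add: algebra_simps power2_eq_square)
  then have "(p + cmod g * q)\<^sup>2 \<le> (1 + (cmod g)\<^sup>2) * (p\<^sup>2 + q\<^sup>2)"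
    by (metis zero_le_power2 le_add_same_cancel1)
  then have "(rot_scale g)\<^sup>2 * (p + cmod g * q)\<^sup>2 \<le> (rot_scale g)\<^sup>2 * ((1 + (cmod g)\<^sup>2) * (p\<^sup>2 + q\<^sup>2))"
    by (rule mult_left_mono) simp
  also have "\<dots> = p\<^sup>2 + q\<^sup>2"
    using rot_scale_sq[of g] by (simp add: mult.assoc[symmetric])
  finally show "(rot_scale g * (p + cmod g * q))\<^sup>2 \<le> p\<^sup>2 + q\<^sup>2"
    by (simp add: power_mult_distrib)
qed

text \<open>The sesquilinear form of K: the vectors \<open>shift_down j a\<close> for
  \<open>j < n\<close> are the columns of T(a).\<close>

definition gram_form :: "nat \<Rightarrow> (nat \<Rightarrow> complex) \<Rightarrow> (nat \<Rightarrow> complex) \<Rightarrow> (nat \<Rightarrow> complex) \<Rightarrow> (nat \<Rightarrow> complex) \<Rightarrow> complex"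
  where "gram_form n a b x y =
    (\<Sum>j<n. outer_form n (shift_down j a) x y + outer_form n (shift_down j b) x y)"

text \<open>The vectors of step \<open>k\<close> are padded by \<open>k\<close> leading zeros to a fixed length \<open>n\<close>; then \<open>L k\<close> is
  the rotated first column before its last entry is dropped, i.e. the \<open>k\<close>-th column of an
  approximate Cholesky factor of the Gram form.\<close>
locale layer_run =
  fixes n :: nat and \<kappa> :: real and g :: "nat \<Rightarrow> complex" and A B L :: "nat \<Rightarrow> nat \<Rightarrow> complex"
  assumes kappa_nonneg: "0 \<le> \<kappa>" and kappa_small: "6 * real n * \<kappa> \<le> 1"
    and rot_L: "\<And>k i. k < n \<Longrightarrow> i < n \<Longrightarrow>
      cmod (L k i - rot_scale (g k) * (A k i + cnj (g k) * B k i))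
        \<le> \<kappa> * rot_scale (g k) * (cmod (A k i) + cmod (g k) * cmod (B k i))"
    and rot_B: "\<And>k i. k < n \<Longrightarrow> i < n \<Longrightarrow>
      cmod (B (Suc k) i - rot_scale (g k) * (B k i - g k * A k i))
        \<le> \<kappa> * rot_scale (g k) * (cmod (B k i) + cmod (g k) * cmod (A k i))"
    and A_Suc: "\<And>k i. k < n \<Longrightarrow> i < n \<Longrightarrow> A (Suc k) i = shift_down (Suc 0) (L k) i"
    and L_zero: "\<And>k i. k < n \<Longrightarrow> i < k \<Longrightarrow> L k i = 0"
    and B_zero: "\<And>i. i < n \<Longrightarrow> B n i = 0"
    and diag: "\<And>k. k < n \<Longrightarrow> cmod (rot_scale (g k) * L k k - A k k) \<le> \<kappa> * cmod (A k k)"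
    and A00: "A 0 0 \<noteq> 0"
    and start: "(vnorm n (A 0))\<^sup>2 + (vnorm n (B 0))\<^sup>2 \<le> 1"
begin

definition rotA :: "nat \<Rightarrow> nat \<Rightarrow> complex" where
  "rotA k i = rot_scale (g k) * (A k i + cnj (g k) * B k i)"

definition rotB :: "nat \<Rightarrow> nat \<Rightarrow> complex" where
  "rotB k i = rot_scale (g k) * (B k i - g k * A k i)"

definition errA :: "nat \<Rightarrow> nat \<Rightarrow> complex" where
  "errA k i = L k i - rotA k i"

definition errB :: "nat \<Rightarrow> nat \<Rightarrow> complex" where
  "errB k i = B (Suc k) i - rotB k i"

text \<open>The squared Frobenius norm of the two working columns. Exact rotations preserve it and
  the truncating shift cannot raise it, so only rounding makes it grow.\<close>

definition mass :: "nat \<Rightarrow> real" where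
  "mass k = (vnorm n (A k))\<^sup>2 + (vnorm n (B k))\<^sup>2"

lemma L_eq: "L k = (\<lambda>i. rotA k i + errA k i)"
  and B_Suc_eq: "B (Suc k) = (\<lambda>i. rotB k i + errB k i)"
  by (auto simp: errA_def errB_def)

lemma mass_nonneg: "0 \<le> mass k"
  by (simp add: mass_def)

lemma rot_mass: "(vnorm n (rotA k))\<^sup>2 + (vnorm n (rotB k))\<^sup>2 = mass k"
  unfolding rotA_def rotB_def mass_def by (rule vnorm_rotate[OF rot_scale_sq])

lemma errA_pre: "vnorm n (errA k) \<le> \<kappa> * (rot_scale (g k) * (vnorm n (A k) + cmod (g k) * vnorm n (B k)))"
  and errB_pre: "vnorm n (errB k) \<le> \<kappa> * (rot_scale (g k) * (vnorm n (B k) + cmod (g k) * vnorm n (A k)))"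
  if "k < n" for k
proof -
  have s: "0 \<le> \<kappa> * rot_scale (g k)" using kappa_nonneg rot_scale_pos[of "g k"] by simp
  have "vnorm n (errA k) \<le> (\<kappa> * rot_scale (g k)) * vnorm n (A k) + (\<kappa> * rot_scale (g k) * cmod (g k)) * vnorm n (B k)"
    using rot_L[OF that] s by (intro vnorm_le_comb mult_nonneg_nonneg[OF s]) (auto simp: errA_def rotA_def algebra_simps)
  then show "vnorm n (errA k) \<le> \<kappa> * (rot_scale (g k) * (vnorm n (A k) + cmod (g k) * vnorm n (B k)))"
    by (simp add: algebra_simps)
  have "vnorm n (errB k) \<le> (\<kappa> * rot_scale (g k)) * vnorm n (B k) + (\<kappa> * rot_scale (g k) * cmod (g k)) * vnorm n (A k)"
    using rot_B[OF that] s by (intro vnorm_le_comb mult_nonneg_nonneg[OF s]) (auto simp: errB_def rotB_def algebra_simps)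
  then show "vnorm n (errB k) \<le> \<kappa> * (rot_scale (g k) * (vnorm n (B k) + cmod (g k) * vnorm n (A k)))"
    by (simp add: algebra_simps)
qed

lemma errA_le: "vnorm n (errA k) \<le> \<kappa> * sqrt (mass k)"
  and errB_le: "vnorm n (errB k) \<le> \<kappa> * sqrt (mass k)" if "k < n" for k
proof -
  show "vnorm n (errA k) \<le> \<kappa> * sqrt (mass k)"
    unfolding mass_def
    by (rule order_trans[OF errA_pre[OF that] mult_left_mono[OF rot_scale_comb_le kappa_nonneg]]) auto
  show "vnorm n (errB k) \<le> \<kappa> * sqrt (mass k)"
    unfolding mass_def add.commute[of "(vnorm n (A k))\<^sup>2"]
    by (rule order_trans[OF errB_pre[OF that] mult_left_mono[OF rot_scale_comb_le kappa_nonneg]]) auto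
qed

lemma kappa_le_1: "0 < n \<Longrightarrow> \<kappa> \<le> 1"
proof -
  assume "0 < n"
  then have "1 * \<kappa> \<le> (6 * real n) * \<kappa>"
    by (intro mult_right_mono kappa_nonneg) simp
  then show "\<kappa> \<le> 1" using kappa_small by simp
qed

text \<open>With \<open>m = sqrt (mass k)\<close> the rotated columns have norm at most
  \<open>m\<close> and their errors at most \<open>\<kappa> * m\<close>. The two cross terms give
  \<open>4 * \<kappa> * m\<^sup>2\<close>, the two squares at most
  \<open>2 * \<kappa> * m\<^sup>2\<close> because \<open>\<kappa> \<le> 1\<close>. The same quantity
  controls both the growth of \<open>mass\<close> and the defect of the form.\<close>

lemma local_err:
  assumes "k < n"
  shows "2 * vnorm n (rotA k) * vnorm n (errA k) + (vnorm n (errA k))\<^sup>2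
       + (2 * vnorm n (rotB k) * vnorm n (errB k) + (vnorm n (errB k))\<^sup>2) \<le> 6 * \<kappa> * mass k"
proof -
  define m where "m = sqrt (mass k)"
  have m: "0 \<le> m" "m\<^sup>2 = mass k" using mass_nonneg[of k] by (auto simp: m_def)
  have "(vnorm n (rotA k))\<^sup>2 \<le> m\<^sup>2" "(vnorm n (rotB k))\<^sup>2 \<le> m\<^sup>2"
    using rot_mass[of k] unfolding m(2)[symmetric]
    using zero_le_power2[of "vnorm n (rotA k)"] zero_le_power2[of "vnorm n (rotB k)"] by linarith+
  then have ra: "vnorm n (rotA k) \<le> m" and rb: "vnorm n (rotB k) \<le> m"
    using m(1) by (auto intro: power2_le_imp_le)
  have e: "vnorm n (errA k) \<le> \<kappa> * m" "vnorm n (errB k) \<le> \<kappa> * m"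
    using errA_le[OF assms] errB_le[OF assms] by (auto simp: m_def)
  have k1: "\<kappa> \<le> 1" using kappa_le_1 assms by simp
  have "2 * vnorm n (rotA k) * vnorm n (errA k) \<le> 2 * m * (\<kappa> * m)"
       "2 * vnorm n (rotB k) * vnorm n (errB k) \<le> 2 * m * (\<kappa> * m)"
    using ra rb e m kappa_nonneg by (auto intro!: mult_mono)
  moreover have "(\<kappa> * m)\<^sup>2 \<le> \<kappa> * m\<^sup>2"
    unfolding power_mult_distrib using k1 kappa_nonneg
    by (intro mult_right_mono) (auto simp: power2_eq_square mult_left_le)
  moreover have "(vnorm n (errA k))\<^sup>2 \<le> (\<kappa> * m)\<^sup>2" "(vnorm n (errB k))\<^sup>2 \<le> (\<kappa> * m)\<^sup>2"
    using e by (auto intro!: power_mono)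
  ultimately have "2 * vnorm n (rotA k) * vnorm n (errA k) + (vnorm n (errA k))\<^sup>2
       + (2 * vnorm n (rotB k) * vnorm n (errB k) + (vnorm n (errB k))\<^sup>2)
       \<le> 2 * (2 * m * (\<kappa> * m)) + 2 * (\<kappa> * m\<^sup>2)" by linarith
  also have "\<dots> = 6 * \<kappa> * mass k" by (simp add: m(2)[symmetric] power2_eq_square)
  finally show ?thesis .
qed

lemma vnorm_add_sq: "(vnorm n (\<lambda>i. v i + w i))\<^sup>2 \<le> (vnorm n v)\<^sup>2 + (2 * vnorm n v * vnorm n w + (vnorm n w)\<^sup>2)"
proof -
  have "(vnorm n (\<lambda>i. v i + w i))\<^sup>2 \<le> (vnorm n v + vnorm n w)\<^sup>2"
    by (intro power_mono vnorm_add) simp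
  then show ?thesis by (simp add: power2_sum)
qed

lemma mass_step: "(vnorm n (L k))\<^sup>2 + (vnorm n (B (Suc k)))\<^sup>2 \<le> (1 + 6 * \<kappa>) * mass k" if "k < n"
  using vnorm_add_sq[of "rotA k" "errA k"] vnorm_add_sq[of "rotB k" "errB k"] local_err[OF that] rot_mass[of k]
  unfolding L_eq[symmetric] B_Suc_eq[symmetric] distrib_right by linarith

lemma A_Suc_norm: "vnorm n (A (Suc k)) \<le> vnorm n (L k)" if "k < n"
proof -
  have "vnorm n (A (Suc k)) = vnorm n (shift_down (Suc 0) (L k))"
    using A_Suc[OF that] by (rule vnorm_cong)
  then show ?thesis using vnorm_shift_down[of n "Suc 0" "L k"] by simp
qed

lemma mass_pow: "k \<le> n \<Longrightarrow> mass k \<le> (1 + 6 * \<kappa>) ^ k"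
proof (induction k)
  case 0
  then show ?case using start by (simp add: mass_def)
next
  case (Suc k)
  have "mass (Suc k) \<le> (vnorm n (L k))\<^sup>2 + (vnorm n (B (Suc k)))\<^sup>2"
    unfolding mass_def using A_Suc_norm[of k] Suc by (auto intro!: power_mono)
  also have "\<dots> \<le> (1 + 6 * \<kappa>) * mass k" using mass_step Suc by simp
  also have "\<dots> \<le> (1 + 6 * \<kappa>) * (1 + 6 * \<kappa>) ^ k"
    using Suc kappa_nonneg by (intro mult_left_mono) auto
  finally show ?case by simp
qed

text \<open>This is what \<open>kappa_small\<close> is made for: the growth over n steps multiplies
  to at most e.\<close>

lemma pow_le_3:
  assumes "k \<le> n" "0 \<le> t" "t \<le> 6 * \<kappa>"
  shows "(1 + t) ^ k \<le> 3"
proof -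
  have "(1 + t) ^ k \<le> exp t ^ k" using assms by (intro power_mono) (auto simp: exp_ge_add_one_self)
  also have "\<dots> = exp (real k * t)" by (simp add: exp_of_nat_mult)
  also have "\<dots> \<le> exp 1"
  proof -
    have "real k * t \<le> real n * (6 * \<kappa>)" using assms by (intro mult_mono) auto
    then show ?thesis using kappa_small by (simp add: algebra_simps)
  qed
  also have "\<dots> \<le> 3" by (rule exp_le)
  finally show ?thesis .
qed

lemma mass_le_3: "k \<le> n \<Longrightarrow> mass k \<le> 3"
  by (rule order_trans[OF mass_pow pow_le_3]) (use kappa_nonneg in auto)

lemma A_norm: "k \<le> n \<Longrightarrow> vnorm n (A k) \<le> 2"
proof (rule power2_le_imp_le)
  assume "k \<le> n"
  from mass_le_3[OF this] have "(vnorm n (A k))\<^sup>2 \<le> 3"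
    unfolding mass_def using zero_le_power2[of "vnorm n (B k)"] by linarith
  then show "(vnorm n (A k))\<^sup>2 \<le> 2\<^sup>2" by simp
qed simp

lemma sqrt_mass_le: "k \<le> n \<Longrightarrow> sqrt (mass k) \<le> 2"
  using mass_le_3[of k] by (simp add: real_le_lsqrt)

lemma L_norm_sq: "k < n \<Longrightarrow> (vnorm n (L k))\<^sup>2 \<le> 6"
proof -
  assume k: "k < n"
  have "6 * \<kappa> \<le> 6 * real n * \<kappa>" using k kappa_nonneg by (intro mult_right_mono) auto
  then have "6 * \<kappa> \<le> 1" using kappa_small by linarith
  then have "(1 + 6 * \<kappa>) * mass k \<le> 2 * 3"
    using mass_le_3[of k] k mass_nonneg[of k] kappa_nonneg by (intro mult_mono) auto
  then show "(vnorm n (L k))\<^sup>2 \<le> 6" using mass_step[OF k] zero_le_power2[of "vnorm n (B (Suc k))"] by linarith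
qed

section \<open>The displacement equation with rounding defects\<close>

definition step_form :: "nat \<Rightarrow> (nat \<Rightarrow> complex) \<Rightarrow> (nat \<Rightarrow> complex) \<Rightarrow> complex" where
  "step_form k x y = outer_form n (L k) x y + outer_form n (B (Suc k)) x y
     - (outer_form n (A k) x y + outer_form n (B k) x y)"

lemma step_form_bound:
  assumes "k < n"
  shows "cmod (step_form k x y) \<le> 18 * \<kappa> * (vnorm n x * vnorm n y)"
proof -
  have "step_form k x y = (outer_form n (L k) x y - outer_form n (rotA k) x y)
      + (outer_form n (B (Suc k)) x y - outer_form n (rotB k) x y)"
    using outer_form_rotate[OF rot_scale_sq[of "g k"], of n "A k" "B k" x y]
    unfolding step_form_def rotA_def[symmetric] rotB_def[symmetric] by (simp add: algebra_simps)
  then have "cmod (step_form k x y) \<le> cmod (outer_form n (L k) x y - outer_form n (rotA k) x y)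
      + cmod (outer_form n (B (Suc k)) x y - outer_form n (rotB k) x y)"
    by (simp only: norm_triangle_ineq)
  also have "\<dots> \<le> (2 * vnorm n (rotA k) * vnorm n (errA k) + (vnorm n (errA k))\<^sup>2) * (vnorm n x * vnorm n y)
      + (2 * vnorm n (rotB k) * vnorm n (errB k) + (vnorm n (errB k))\<^sup>2) * (vnorm n x * vnorm n y)"
    using outer_form_add_bound[of n "rotA k" "errA k" x y] outer_form_add_bound[of n "rotB k" "errB k" x y]
    unfolding L_eq[symmetric] B_Suc_eq[symmetric] by (rule add_mono)
  also have "\<dots> \<le> (6 * \<kappa> * mass k) * (vnorm n x * vnorm n y)"
    unfolding distrib_right[symmetric] by (rule mult_right_mono[OF local_err[OF assms]]) simp
  also have "\<dots> \<le> (6 * \<kappa> * 3) * (vnorm n x * vnorm n y)"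
    using mass_le_3[of k] assms kappa_nonneg by (intro mult_right_mono mult_left_mono) auto
  finally show ?thesis by simp
qed

definition chol_form :: "(nat \<Rightarrow> complex) \<Rightarrow> (nat \<Rightarrow> complex) \<Rightarrow> complex" where
  "chol_form x y = (\<Sum>k<n. outer_form n (L k) x y)"

lemma outer_form_zero: "(\<And>i. i < n \<Longrightarrow> v i = 0) \<Longrightarrow> outer_form n v x y = 0"
  by (simp add: outer_form_def vinner_def)

text \<open>Since \<open>A (Suc k)\<close> is the shifted \<open>L k\<close>, the left side sums the
  form of \<open>L k\<close> minus that of \<open>A (Suc k)\<close>. Adding and subtracting the form
  of \<open>B (Suc k)\<close> makes it telescope from the input pair to the final pair. The final
  pair vanishes: \<open>B n\<close> by assumption, \<open>A n\<close> because everything has been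
  shifted beyond index n - 1.\<close>

lemma displacement:
  assumes "0 < n"
  shows "chol_form x y - chol_form (shift_up n (Suc 0) x) (shift_up n (Suc 0) y)
    = outer_form n (A 0) x y + outer_form n (B 0) x y + (\<Sum>k<n. step_form k x y)"
proof -
  have sh: "outer_form n (A (Suc k)) x y = outer_form n (L k) (shift_up n (Suc 0) x) (shift_up n (Suc 0) y)"
    if "k < n" for k
    unfolding outer_form_shift[symmetric] using A_Suc[OF that]
    by (auto simp: outer_form_def intro!: arg_cong2[of _ _ _ _ "(*)"] vinner_cong)
  have An: "outer_form n (A n) x y = 0"
  proof (rule outer_form_zero)
    fix i assume i: "i < n"
    obtain m where m: "n = Suc m" using assms by (cases n) auto
    show "A n i = 0" using A_Suc[of m i] L_zero[of m "i - 1"] i m by (auto simp: shift_down_def)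
  qed
  have Bn: "outer_form n (B n) x y = 0" using B_zero by (intro outer_form_zero)
  have "chol_form x y - chol_form (shift_up n (Suc 0) x) (shift_up n (Suc 0) y)
      = (\<Sum>k<n. outer_form n (L k) x y - outer_form n (A (Suc k)) x y)"
    unfolding chol_form_def sum_subtractf[symmetric] using sh by (intro sum.cong) auto
  also have "\<dots> = (\<Sum>k<n. step_form k x y - ((outer_form n (A (Suc k)) x y + outer_form n (B (Suc k)) x y)
        - (outer_form n (A k) x y + outer_form n (B k) x y)))"
    by (intro sum.cong) (auto simp: step_form_def)
  also have "\<dots> = (\<Sum>k<n. step_form k x y) - ((outer_form n (A n) x y + outer_form n (B n) x y)
        - (outer_form n (A 0) x y + outer_form n (B 0) x y))"
    unfolding sum_subtractf[of "\<lambda>k. step_form k x y"]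
    by (subst sum_lessThan_telescope) simp
  finally show ?thesis by (simp add: An Bn)
qed

lemma chol_form_cong:
  "(\<And>i. i < n \<Longrightarrow> x i = x' i) \<Longrightarrow> (\<And>i. i < n \<Longrightarrow> y i = y' i) \<Longrightarrow> chol_form x y = chol_form x' y'"
  unfolding chol_form_def outer_form_def vinner_def by simp

text \<open>The shift is nilpotent, so telescoping the displacement equation over all its powers
  below n recovers the full form. Each of the n shifts picks up n defects, which is where n^2
  enters.\<close>

lemma chol_form_gram:
  assumes "0 < n"
  shows "chol_form x y - gram_form n (A 0) (B 0) x y
       = (\<Sum>j<n. \<Sum>k<n. step_form k (shift_up n j x) (shift_up n j y))"
proof -
  let ?c = "\<lambda>j. chol_form (shift_up n j x) (shift_up n j y)"
  have "chol_form x y = ?c 0 - ?c n"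
  proof -
    have "?c n = 0" unfolding chol_form_def outer_form_def
      by (intro sum.neutral) (auto simp: shift_up_def vinner_def)
    moreover have "?c 0 = chol_form x y" by (intro chol_form_cong) (auto simp: shift_up_0)
    ultimately show ?thesis by simp
  qed
  also have "\<dots> = (\<Sum>j<n. ?c j - ?c (Suc j))"
    by (subst sum_lessThan_telescope') simp
  also have "\<dots> = (\<Sum>j<n. (outer_form n (shift_down j (A 0)) x y + outer_form n (shift_down j (B 0)) x y)
      + (\<Sum>k<n. step_form k (shift_up n j x) (shift_up n j y)))"
    using displacement[OF assms, of "shift_up n j x" "shift_up n j y" for j]
    by (simp only: outer_form_shift shift_up_Suc)
  finally show ?thesis by (simp add: gram_form_def sum.distrib)
qed

lemma chol_gram_bound:
  assumes "0 < n"
  shows "cmod (chol_form x y - gram_form n (A 0) (B 0) x y)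
    \<le> 18 * (real n)\<^sup>2 * \<kappa> * (vnorm n x * vnorm n y)"
proof -
  have "cmod (step_form k (shift_up n j x) (shift_up n j y)) \<le> 18 * \<kappa> * (vnorm n x * vnorm n y)"
    if "k < n" for j k
    by (rule order_trans[OF step_form_bound[OF that] mult_left_mono[OF mult_mono]])
       (use kappa_nonneg in \<open>auto simp: vnorm_shift_up\<close>)
  then have "cmod (\<Sum>j<n. \<Sum>k<n. step_form k (shift_up n j x) (shift_up n j y))
      \<le> (\<Sum>j<n. \<Sum>k<n. 18 * \<kappa> * (vnorm n x * vnorm n y))"
    by (intro sum_norm_le) auto
  then show ?thesis unfolding chol_form_gram[OF assms] by (simp add: power2_eq_square algebra_simps)
qed

end

section \<open>Reading the coefficients off the computed factor\<close>

context layer_run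
begin

definition scale_prod :: "nat \<Rightarrow> real" where
  "scale_prod k = (\<Prod>j<k. rot_scale (g j))"

lemma scale_prod_bounds: "0 \<le> scale_prod k" "scale_prod k \<le> 1"
  unfolding scale_prod_def using rot_scale_pos rot_scale_le_1
  by (auto intro!: prod_nonneg prod_le_1 simp: less_imp_le)

text \<open>The backward error of b: \<open>B 0 + resid\<close> is an exact combination of the
  computed columns. The local errors are carried back to step 0, damped by the cosines passed on the
  way.\<close>

definition resid :: "nat \<Rightarrow> complex" where
  "resid i = (\<Sum>k<n. scale_prod (Suc k) * (g k * errA k i + errB k i))"

lemma B_unrotate: "B k i = rot_scale (g k) * (g k * L k i + B (Suc k) i) - rot_scale (g k) * (g k * errA k i + errB k i)"
proof -
  have s: "complex_of_real (rot_scale (g k)) * rot_scale (g k) * (1 + g k * cnj (g k)) = 1"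
    using arg_cong[OF rot_scale_sq[of "g k"], of complex_of_real]
    unfolding of_real_mult of_real_add complex_norm_square by (simp add: power2_eq_square)
  have "rot_scale (g k) * (g k * rotA k i + rotB k i)
     = (complex_of_real (rot_scale (g k)) * rot_scale (g k) * (1 + g k * cnj (g k))) * B k i"
    by (simp add: rotA_def rotB_def algebra_simps)
  then have "B k i = rot_scale (g k) * (g k * rotA k i + rotB k i)"
    unfolding s by simp
  then show ?thesis by (simp add: errA_def errB_def algebra_simps)
qed

text \<open>Iterates \<open>B_unrotate\<close>: each unrotation splits off one column and multiplies
  the remainder by another cosine. The remainder disappears once \<open>B n\<close> is
  reached.\<close>

lemma B0_expand_aux:
  "B 0 i + (\<Sum>k<m. scale_prod (Suc k) * (g k * errA k i + errB k i))
     = (\<Sum>k<m. (scale_prod (Suc k) * g k) * L k i) + scale_prod m * B m i"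
proof (induction m)
  case (Suc m)
  have "scale_prod m * B m i = scale_prod (Suc m) * (g m * L m i + B (Suc m) i)
      - scale_prod (Suc m) * (g m * errA m i + errB m i)"
    by (subst B_unrotate) (simp add: scale_prod_def algebra_simps)
  then show ?case using Suc by (simp only: sum.lessThan_Suc) (simp only: algebra_simps)
qed (simp add: scale_prod_def)

lemma B0_expand: "i < n \<Longrightarrow> B 0 i + resid i = (\<Sum>k<n. (scale_prod (Suc k) * g k) * L k i)"
  using B0_expand_aux[of i n] B_zero by (simp add: resid_def)

text \<open>Unlike \<open>errB_le\<close>, this bound is small when \<open>B k\<close> and
  \<open>g k\<close> are small, which a relative error estimate requires. The 2 bounds
  \<open>vnorm n (A k)\<close>.\<close>

lemma errB_le_B: "k < n \<Longrightarrow> vnorm n (errB k) \<le> \<kappa> * (vnorm n (B k) + 2 * cmod (g k))"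
proof -
  assume k: "k < n"
  have "cmod (g k) * vnorm n (A k) \<le> cmod (g k) * 2"
    using A_norm[of k] k by (intro mult_left_mono) auto
  then have "rot_scale (g k) * (vnorm n (B k) + cmod (g k) * vnorm n (A k)) \<le> 1 * (vnorm n (B k) + 2 * cmod (g k))"
    using rot_scale_le_1 rot_scale_pos[of "g k"] by (intro mult_mono) (auto simp: less_imp_le)
  then have "\<kappa> * (rot_scale (g k) * (vnorm n (B k) + cmod (g k) * vnorm n (A k))) \<le> \<kappa> * (vnorm n (B k) + 2 * cmod (g k))"
    using kappa_nonneg by (intro mult_left_mono) auto
  with errB_pre[OF k] show ?thesis by linarith
qed

lemma rotB_le_B: "k < n \<Longrightarrow> vnorm n (rotB k) \<le> vnorm n (B k) + 2 * cmod (g k)"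
proof -
  assume k: "k < n"
  have "vnorm n (rotB k) \<le> 1 * vnorm n (B k) + cmod (g k) * vnorm n (A k)"
  proof (rule vnorm_le_comb)
    fix i
    have "cmod (rotB k i) = rot_scale (g k) * cmod (B k i - g k * A k i)"
      using rot_scale_pos[of "g k"] by (simp add: rotB_def norm_mult)
    also have "\<dots> \<le> 1 * (cmod (B k i) + cmod (g k) * cmod (A k i))"
      using rot_scale_le_1 rot_scale_pos[of "g k"] norm_triangle_ineq4[of "B k i" "g k * A k i"]
      by (intro mult_mono) (auto simp: norm_mult)
    finally show "cmod (rotB k i) \<le> 1 * cmod (B k i) + cmod (g k) * cmod (A k i)" by simp
  qed auto
  moreover have "cmod (g k) * vnorm n (A k) \<le> cmod (g k) * 2"
    using A_norm[of k] k by (intro mult_left_mono) auto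
  ultimately show ?thesis by simp
qed

text \<open>Keeps every \<open>B k\<close> proportional to \<open>B 0\<close> and the coefficients,
  where \<open>mass\<close> would only give a constant.\<close>

lemma B_norm_pow: "k \<le> n \<Longrightarrow> vnorm n (B k) \<le> (1 + \<kappa>) ^ k * (vnorm n (B 0) + 2 * (\<Sum>j<k. cmod (g j)))"
proof (induction k)
  case (Suc k)
  have "vnorm n (B (Suc k)) \<le> vnorm n (rotB k) + vnorm n (errB k)"
    unfolding B_Suc_eq by (rule vnorm_add)
  also have "\<dots> \<le> (1 + \<kappa>) * (vnorm n (B k) + 2 * cmod (g k))"
    using rotB_le_B[of k] errB_le_B[of k] Suc by (simp add: algebra_simps)
  also have "\<dots> \<le> (1 + \<kappa>) * ((1 + \<kappa>) ^ k * (vnorm n (B 0) + 2 * (\<Sum>j<k. cmod (g j))) + (1 + \<kappa>) ^ k * (2 * cmod (g k)))"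
  proof -
    have "1 * (2 * cmod (g k)) \<le> (1 + \<kappa>) ^ k * (2 * cmod (g k))"
      using kappa_nonneg by (intro mult_right_mono) auto
    then show ?thesis using Suc kappa_nonneg by (intro mult_left_mono add_mono) auto
  qed
  finally show ?case by (simp add: algebra_simps)
qed simp

lemma B_norm: "k \<le> n \<Longrightarrow> vnorm n (B k) \<le> 3 * (vnorm n (B 0) + 2 * (\<Sum>j<n. cmod (g j)))"
proof -
  assume k: "k \<le> n"
  have "(\<Sum>j<k. cmod (g j)) \<le> (\<Sum>j<n. cmod (g j))" using k by (intro sum_mono2) auto
  moreover have "(1 + \<kappa>) ^ k \<le> 3" using pow_le_3[OF k, of \<kappa>] kappa_nonneg by auto
  ultimately have "(1 + \<kappa>) ^ k * (vnorm n (B 0) + 2 * (\<Sum>j<k. cmod (g j))) \<le> 3 * (vnorm n (B 0) + 2 * (\<Sum>j<n. cmod (g j)))"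
    by (intro mult_mono) (auto intro!: add_nonneg_nonneg sum_nonneg)
  then show ?thesis using B_norm_pow[OF k] by linarith
qed

lemma resid_norm:
  assumes "0 < n"
  shows "vnorm n resid \<le> 10 * real n * \<kappa> * (vnorm n (B 0) + (\<Sum>j<n. cmod (g j)))"
proof -
  define G where "G = (\<Sum>j<n. cmod (g j))"
  have G: "0 \<le> G" by (auto simp: G_def intro: sum_nonneg)
  have one: "vnorm n (\<lambda>i. g k * errA k i + errB k i) \<le> \<kappa> * (4 * cmod (g k) + 3 * (vnorm n (B 0) + 2 * G))"
    if k: "k < n" for k
  proof -
    have "vnorm n (errA k) \<le> \<kappa> * 2"
      using errA_le[OF k] mult_left_mono[OF sqrt_mass_le[of k] kappa_nonneg] k by linarith
    then have "cmod (g k) * vnorm n (errA k) \<le> cmod (g k) * (\<kappa> * 2)" by (intro mult_left_mono) auto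
    moreover have "\<kappa> * vnorm n (B k) \<le> \<kappa> * (3 * (vnorm n (B 0) + 2 * G))"
      unfolding G_def using B_norm[of k] k kappa_nonneg by (intro mult_left_mono) auto
    moreover have "vnorm n (\<lambda>i. g k * errA k i + errB k i) \<le> cmod (g k) * vnorm n (errA k) + vnorm n (errB k)"
      using vnorm_add[of n "\<lambda>i. g k * errA k i" "errB k"] by (simp add: vnorm_scale)
    ultimately show ?thesis using errB_le_B[OF k] by (simp add: algebra_simps)
  qed
  have "vnorm n resid \<le> (\<Sum>k<n. cmod (scale_prod (Suc k)) * vnorm n (\<lambda>i. g k * errA k i + errB k i))"
    using vnorm_sum_le[of "{..<n}" n "\<lambda>k. scale_prod (Suc k)" "\<lambda>k i. g k * errA k i + errB k i"]
    by (simp add: resid_def[abs_def])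
  also have "\<dots> \<le> (\<Sum>k<n. 1 * (\<kappa> * (4 * cmod (g k) + 3 * (vnorm n (B 0) + 2 * G))))"
    using one scale_prod_bounds by (intro sum_mono mult_mono) auto
  also have "\<dots> = \<kappa> * (4 * G + real n * (3 * (vnorm n (B 0) + 2 * G)))"
    by (simp add: G_def sum.distrib sum_distrib_left[symmetric])
  also have "\<dots> \<le> \<kappa> * (10 * real n * (vnorm n (B 0) + G))"
  proof (rule mult_left_mono[OF _ kappa_nonneg])
    have "1 * G \<le> real n * G" using assms G by (intro mult_right_mono) auto
    moreover have "0 \<le> real n * vnorm n (B 0)" by simp
    ultimately show "4 * G + real n * (3 * (vnorm n (B 0) + 2 * G)) \<le> 10 * real n * (vnorm n (B 0) + G)"
      unfolding distrib_left mult.assoc mult.left_commute[of "real n"] by linarith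
  qed
  finally show ?thesis by (simp add: G_def algebra_simps)
qed

text \<open>In exact arithmetic \<open>B k k = g k * A k k\<close>, hence
  \<open>rot_scale (g k) * L k k = A k k\<close> and every factor is 1. The product collects the
  actual ratios.\<close>

definition drift :: "nat \<Rightarrow> complex" where
  "drift k = (\<Prod>j\<le>k. 1 + (rot_scale (g j) * L j j - A j j) / A j j)"

text \<open>A zero pivot is harmless here: \<open>diag\<close> then forces \<open>L k k = 0\<close>,
  and with \<open>x / 0 = 0\<close> the factor is 1. So nonzero pivots can be deduced afterwards, in
  \<open>L_diag_nonzero\<close>.\<close>

lemma drift_factor:
  assumes "k < n"
  shows "cmod ((rot_scale (g k) * L k k - A k k) / A k k) \<le> \<kappa>"
    "rot_scale (g k) * L k k = A k k * (1 + (rot_scale (g k) * L k k - A k k) / A k k)"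
proof -
  show "cmod ((rot_scale (g k) * L k k - A k k) / A k k) \<le> \<kappa>"
    using diag[OF assms] kappa_nonneg by (cases "A k k = 0") (auto simp: norm_divide divide_le_eq)
  show "rot_scale (g k) * L k k = A k k * (1 + (rot_scale (g k) * L k k - A k k) / A k k)"
    using diag[OF assms] by (cases "A k k = 0") (auto simp: distrib_left)
qed

text \<open>The pivots form a chain: the shift moves \<open>L k k\<close> to
  \<open>A (Suc k) (Suc k)\<close>, and each step contributes its own factor.\<close>

lemma diag_prod: "k < n \<Longrightarrow> scale_prod (Suc k) * L k k = A 0 0 * drift k"
proof (induction k)
  case 0
  then show ?case using drift_factor(2)[of 0] by (simp add: scale_prod_def drift_def)
next
  case (Suc k)
  have "A (Suc k) (Suc k) = L k k" using A_Suc[of k "Suc k"] Suc by (simp add: shift_down_def)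
  then have "scale_prod (Suc (Suc k)) * L (Suc k) (Suc k)
     = scale_prod (Suc k) * (L k k * (1 + (rot_scale (g (Suc k)) * L (Suc k) (Suc k) - A (Suc k) (Suc k)) / A (Suc k) (Suc k)))"
    using drift_factor(2)[of "Suc k"] Suc by (simp add: scale_prod_def)
  also have "\<dots> = A 0 0 * drift k * (1 + (rot_scale (g (Suc k)) * L (Suc k) (Suc k) - A (Suc k) (Suc k)) / A (Suc k) (Suc k))"
    using Suc by simp
  also have "\<dots> = A 0 0 * drift (Suc k)" by (simp only: drift_def prod.atMost_Suc mult.assoc)
  finally show ?case .
qed

lemma drift_bound:
  assumes "k < n"
  shows "cmod (drift k - 1) \<le> 2 * real n * \<kappa>"
proof -
  have "cmod (drift k - 1) \<le> (\<Prod>j\<le>k. 1 + cmod ((rot_scale (g j) * L j j - A j j) / A j j)) - 1"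
    unfolding drift_def by (rule norm_prod_minus1_le_prod_minus1)
  also have "\<dots> \<le> (\<Prod>j\<le>k. 1 + \<kappa>) - 1"
    using drift_factor(1) assms by (intro diff_right_mono prod_mono) auto
  also have "\<dots> = (1 + \<kappa>) ^ Suc k - 1" by simp
  also have "\<dots> \<le> (1 + \<kappa>) ^ n - 1"
    using assms kappa_nonneg by (intro diff_right_mono power_increasing) auto
  also have "\<dots> \<le> exp \<kappa> ^ n - 1"
    using kappa_nonneg by (intro diff_right_mono power_mono) (auto simp: exp_ge_add_one_self)
  also have "\<dots> = exp (real n * \<kappa>) - 1" by (simp add: exp_of_nat_mult)
  also have "\<dots> \<le> real n * \<kappa> + (real n * \<kappa>)\<^sup>2"
    using exp_bound[of "real n * \<kappa>"] kappa_nonneg kappa_small by simp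
  also have "\<dots> \<le> real n * \<kappa> + real n * \<kappa> * 1"
    unfolding power2_eq_square using kappa_nonneg kappa_small by (intro add_left_mono mult_left_mono) auto
  finally show ?thesis by (simp add: mult_ac)
qed

text \<open>A vanishing entry would make \<open>drift k\<close> zero, at distance 1 from 1, while
  \<open>drift_bound\<close> and \<open>kappa_small\<close> allow at most 1/3.\<close>

lemma L_diag_nonzero: "k < n \<Longrightarrow> L k k \<noteq> 0"
proof
  assume k: "k < n" "L k k = 0"
  then have "drift k = 0" using diag_prod[of k] A00 by simp
  then have "1 \<le> 2 * real n * \<kappa>" using drift_bound[OF k(1)] by simp
  then show False using kappa_small by linarith
qed

text \<open>\<open>u\<close> annihilates \<open>L j\<close> for \<open>j < k\<close>, and for
  \<open>j > k\<close> the supports are disjoint. So only column \<open>k\<close> survives when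
  \<open>u\<close> is paired with the expansion of b, which isolates \<open>g k\<close>, and
  \<open>chol_form u u\<close> is the single square of \<open>L k k\<close>. The vanishing of
  \<open>chol_form w u\<close> is the stationarity condition of the minimisation.\<close>

lemma dual_vector:
  assumes "k < n"
  obtains u where "u k = 1" "\<And>i. k < i \<Longrightarrow> u i = 0"
    "\<And>w. (\<And>i. k \<le> i \<Longrightarrow> w i = 0) \<Longrightarrow> chol_form w u = 0"
    "cmod (chol_form u u) \<le> 6"
    "vinner n u (B 0) + vinner n u resid = g k * A 0 0 * drift k"
proof -
  obtain u where u: "u k = 1" "\<And>i. k < i \<Longrightarrow> u i = 0" "\<And>j. j < k \<Longrightarrow> vinner n u (L j) = 0"
    using lower_triangular_dual_basis[of k n L] assms L_diag_nonzero L_zero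
    by (metis dual_order.strict_trans order.strict_trans1)
  have hi: "vinner n w (L j) = 0" if "k' \<le> j" "j < n" "\<And>i. k' \<le> i \<Longrightarrow> w i = 0" for w j k'
    unfolding vinner_def using that L_zero[of j]
    by (intro sum.neutral ballI) (metis complex_cnj_zero mult_eq_0_iff not_le order.strict_trans2 leI)
  have uk: "vinner n u (L k) = L k k"
  proof -
    have "vinner n u (L k) = (\<Sum>i\<in>{k}. cnj (u i) * L k i)"
      unfolding vinner_def using assms u(2) L_zero[of k]
      by (intro sum.mono_neutral_right) (auto, metis linorder_neqE_nat)
    then show ?thesis using u by simp
  qed
  have uj: "vinner n u (L j) = (if j = k then L k k else 0)" if "j < n" for j
    using u(3)[of j] uk hi[of "Suc k" j u] u(2) that by (cases j k rule: linorder_cases) auto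
  show ?thesis
  proof
    show "u k = 1" "\<And>i. k < i \<Longrightarrow> u i = 0" by fact+
    show "chol_form w u = 0" if "\<And>i. k \<le> i \<Longrightarrow> w i = 0" for w
      unfolding chol_form_def outer_form_def
    proof (intro sum.neutral ballI)
      fix j assume j: "j \<in> {..<n}"
      show "vinner n w (L j) * vinner n (L j) u = 0"
      proof (cases "j < k")
        case True
        then show ?thesis using u(3) vinner_commute[of n "L j" u] by simp
      next
        case False
        then show ?thesis using hi[of k j w] that j by simp
      qed
    qed
    have "chol_form u u = (\<Sum>j<n. if j = k then complex_of_real ((cmod (L k k))\<^sup>2) else 0)"
      unfolding chol_form_def outer_form_self vinner_commute[of n _ u]
      by (intro sum.cong) (auto simp: uj)
    then have "cmod (chol_form u u) = (cmod (L k k))\<^sup>2" using assms by (simp flip: of_real_power)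
    also have "\<dots> \<le> (vnorm n (L k))\<^sup>2" using norm_le_vnorm[OF assms] by (intro power_mono) auto
    also have "\<dots> \<le> 6" by (rule L_norm_sq[OF assms])
    finally show "cmod (chol_form u u) \<le> 6" .
    have "vinner n u (B 0) + vinner n u resid = vinner n u (\<lambda>i. \<Sum>j<n. (scale_prod (Suc j) * g j) * L j i)"
      unfolding vinner_add_right[symmetric] by (rule vinner_cong) (auto simp: B0_expand)
    also have "\<dots> = (\<Sum>j<n. (scale_prod (Suc j) * g j) * vinner n u (L j))"
      by (rule vinner_sum_right)
    also have "\<dots> = (\<Sum>j<n. if j = k then (scale_prod (Suc k) * g k) * L k k else 0)"
      by (intro sum.cong) (auto simp: uj)
    also have "\<dots> = g k * (scale_prod (Suc k) * L k k)" using assms by simp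
    also have "\<dots> = g k * A 0 0 * drift k" unfolding diag_prod[OF assms] by simp
    finally show "vinner n u (B 0) + vinner n u resid = g k * A 0 0 * drift k" .
  qed
qed

text \<open>The expansion of b uses columns of norm at most 3. In the exact run \<open>resid\<close>
  vanishes, so every error proportional to b becomes proportional to \<gamma>.\<close>

lemma B0_norm: "vnorm n (B 0) \<le> vnorm n resid + 3 * (\<Sum>k<n. cmod (g k))"
proof -
  have "vnorm n (B 0) = vnorm n (\<lambda>i. (\<Sum>k<n. (scale_prod (Suc k) * g k) * L k i) + (- 1) * resid i)"
    by (rule vnorm_cong) (simp add: B0_expand[symmetric])
  also have "\<dots> \<le> vnorm n (\<lambda>i. \<Sum>k<n. (scale_prod (Suc k) * g k) * L k i) + vnorm n (\<lambda>i. (- 1) * resid i)"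
    by (rule vnorm_add)
  also have "\<dots> \<le> (\<Sum>k<n. cmod (scale_prod (Suc k) * g k) * vnorm n (L k)) + vnorm n resid"
    using vnorm_sum_le[of "{..<n}" n "\<lambda>k. scale_prod (Suc k) * g k" L] vnorm_scale[of n "-1" resid] by simp
  also have "(\<Sum>k<n. cmod (scale_prod (Suc k) * g k) * vnorm n (L k)) \<le> (\<Sum>k<n. cmod (g k) * 3)"
  proof (intro sum_mono mult_mono)
    fix k assume "k \<in> {..<n}"
    then have "(vnorm n (L k))\<^sup>2 \<le> 3\<^sup>2" using L_norm_sq[of k] by simp
    then show "vnorm n (L k) \<le> 3" by (rule power2_le_imp_le) simp
    show "cmod (scale_prod (Suc k) * g k) \<le> cmod (g k)"
      using scale_prod_bounds[of "Suc k"] by (simp add: norm_mult mult_left_le_one_le)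
  qed auto
  finally show ?thesis by (simp add: sum_distrib_left mult.commute)
qed

end

section \<open>Comparison with the exact recursion\<close>

lemma gram_form_diff_right:
  "gram_form n a b x (\<lambda>i. y i - z i) = gram_form n a b x y - gram_form n a b x z"
proof -
  have "vinner n v (\<lambda>i. y i - z i) = vinner n v y - vinner n v z" for v
    by (simp add: vinner_def right_diff_distrib sum_subtractf)
  then show ?thesis
    by (simp add: gram_form_def outer_form_def right_diff_distrib sum_subtractf sum.distrib)
qed

text \<open>A Galerkin argument. The dual vectors of the two runs differ by some \<open>w\<close>
  supported below \<open>k\<close>, so both stationarity conditions apply to it: K(w, w) = K(w, u) =
  K(w, u) - \<open>R.chol_form w u\<close>. Coercivity then bounds \<open>w\<close> by the
  perturbation of the form times the size of \<open>u\<close>.\<close>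

lemma layer_run_compare:
  fixes \<eta> :: real
  assumes run: "layer_run n \<kappa> g A B L" and exact: "layer_run n 0 h A' B' L'"
    and same: "A' 0 = A 0" "B' 0 = B 0"
    and coercive: "\<And>x. \<eta> * (vnorm n x)\<^sup>2 \<le> cmod (gram_form n (A 0) (B 0) x x)"
    and \<eta>: "0 < \<eta>" "\<eta> \<le> 1" and small: "36 * (real n)\<^sup>2 * \<kappa> \<le> \<eta>"
    and A0: "sqrt \<eta> \<le> cmod (A 0 0)" and k: "k < n"
  shows "cmod (g k - h k) \<le> 400 * (real n)\<^sup>2 * \<kappa> / \<eta>\<^sup>2 * ((\<Sum>j<n. cmod (h j)) + (\<Sum>j<n. cmod (g j)))"
proof -
  interpret R: layer_run n \<kappa> g A B L by fact
  interpret X: layer_run n 0 h A' B' L' by fact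
  have n: "0 < n" using k by simp
  define K where "K = gram_form n (A 0) (B 0)"
  define E where "E = 18 * (real n)\<^sup>2 * \<kappa>"
  define G where "G = (\<Sum>j<n. cmod (g j))"
  define H where "H = (\<Sum>j<n. cmod (h j))"
  have GH: "0 \<le> G" "0 \<le> H" by (auto simp: G_def H_def intro: sum_nonneg)
  have \<kappa>: "0 \<le> \<kappa>" by (rule R.kappa_nonneg)
  have E: "0 \<le> E" "2 * E \<le> \<eta>" using \<kappa> small by (auto simp: E_def)
  have KR: "cmod (R.chol_form x y - K x y) \<le> E * (vnorm n x * vnorm n y)" for x y
    using R.chol_gram_bound[OF n] by (simp add: K_def E_def)
  have KX: "X.chol_form x y = K x y" for x y
    using X.chol_gram_bound[OF n, of x y] by (simp add: K_def same)
  obtain u where u: "u k = 1" "\<And>i. k < i \<Longrightarrow> u i = 0"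
    "\<And>w. (\<And>i. k \<le> i \<Longrightarrow> w i = 0) \<Longrightarrow> R.chol_form w u = 0"
    "cmod (R.chol_form u u) \<le> 6"
    "vinner n u (B 0) + vinner n u R.resid = g k * A 0 0 * R.drift k"
    using R.dual_vector[OF k] by metis
  obtain v where v: "v k = 1" "\<And>i. k < i \<Longrightarrow> v i = 0"
    "\<And>w. (\<And>i. k \<le> i \<Longrightarrow> w i = 0) \<Longrightarrow> X.chol_form w v = 0"
    "vinner n v (B' 0) + vinner n v X.resid = h k * A' 0 0 * X.drift k"
    using X.dual_vector[OF k] by metis
  \<comment> \<open>At error level 0 residual and drift are trivial, so \<open>h k * A 0 0\<close>
    is the plain pairing of \<open>v\<close> with b.\<close>
  have Xres: "vnorm n X.resid = 0"
    using X.resid_norm[OF n] vnorm_nonneg[of n X.resid] by simp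
  have Xdrift: "X.drift k = 1" using X.drift_bound[OF k] by simp
  have hk: "vinner n v (B 0) = h k * A 0 0"
    using v(4) vinner_bound[of n v X.resid] by (simp add: Xres Xdrift same)
  have B0: "vnorm n (B 0) \<le> 3 * H" using X.B0_norm by (simp add: Xres same H_def)
  define w where "w = (\<lambda>i. u i - v i)"
  have w0: "w i = 0" if "k \<le> i" for i
    using that u(1) u(2)[of i] v(1) v(2)[of i] by (cases "i = k") (auto simp: w_def)
  \<comment> \<open>Half of the coercivity absorbs the perturbation, since
    \<open>2 * E \<le> \<eta>\<close>. This leaves a squared norm of at most 12 / \<eta>.\<close>
  have u_norm: "vnorm n u \<le> 4 / sqrt \<eta>"
  proof -
    have "cmod (K u u) \<le> cmod (R.chol_form u u) + cmod (R.chol_form u u - K u u)"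
      by (metis norm_triangle_sub norm_minus_commute add.commute)
    then have "\<eta> * (vnorm n u)\<^sup>2 \<le> 6 + E * (vnorm n u)\<^sup>2"
      using coercive[of u] u(4) KR[of u u] by (simp add: K_def power2_eq_square)
    moreover have "E * (vnorm n u)\<^sup>2 \<le> \<eta> / 2 * (vnorm n u)\<^sup>2"
      using E by (intro mult_right_mono) auto
    ultimately have "\<eta> * (vnorm n u)\<^sup>2 \<le> 16" by simp
    then have "(vnorm n u)\<^sup>2 \<le> (4 / sqrt \<eta>)\<^sup>2" using \<eta> by (simp add: power_divide field_simps)
    then show ?thesis by (rule power2_le_imp_le) (use \<eta> in auto)
  qed
  have w_norm: "vnorm n w \<le> E / \<eta> * (4 / sqrt \<eta>)"
  proof -
    have "K w w = K w u - K w v"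
      unfolding K_def by (subst (2) w_def) (rule gram_form_diff_right)
    also have "K w v = 0" using v(3)[OF w0] KX by simp
    finally have "K w w = K w u" by simp
    moreover have "cmod (K w u) \<le> E * (vnorm n w * vnorm n u)"
      using KR[of w u] u(3)[OF w0] by simp
    ultimately have "\<eta> * (vnorm n w)\<^sup>2 \<le> E * (vnorm n w * vnorm n u)"
      using coercive[of w] by (simp add: K_def)
    then have "vnorm n w * (\<eta> * vnorm n w) \<le> vnorm n w * (E * vnorm n u)"
      by (simp add: power2_eq_square mult_ac)
    then have "\<eta> * vnorm n w \<le> E * vnorm n u"
    proof (cases "vnorm n w = 0")
      case False
      then have "0 < vnorm n w" using vnorm_nonneg[of n w] by linarith
      then show ?thesis using \<open>vnorm n w * (\<eta> * vnorm n w) \<le> vnorm n w * (E * vnorm n u)\<close> by simp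
    qed (use E in simp)
    also have "\<dots> \<le> E * (4 / sqrt \<eta>)" using E u_norm by (intro mult_left_mono) auto
    finally show ?thesis using \<eta> by (simp add: field_simps)
  qed
  define N where "N = (real n)\<^sup>2 * \<kappa> / \<eta>\<^sup>2"
  have \<eta>s: "sqrt \<eta> * sqrt \<eta> = \<eta>" "0 < sqrt \<eta>" using \<eta> by auto
  have n1: "real n \<le> (real n)\<^sup>2" using n by (simp add: power2_eq_square)
  have \<eta>2: "\<eta>\<^sup>2 \<le> \<eta>" "\<eta>\<^sup>2 \<le> 1" "0 < \<eta>\<^sup>2"
    using \<eta> by (auto simp: power2_eq_square mult_left_le mult_le_one)
  \<comment> \<open>Three sources of error: the change of the dual vector, the residual in b, and
    the drift of the pivots.\<close>
  have "g k * A 0 0 - h k * A 0 0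
      = vinner n w (B 0) + vinner n u R.resid - g k * A 0 0 * (R.drift k - 1)"
    using u(5) hk unfolding w_def vinner_diff_left by (simp add: algebra_simps)
  then have "cmod (A 0 0) * cmod (g k - h k) \<le> cmod (vinner n w (B 0)) + cmod (vinner n u R.resid)
      + cmod (g k * A 0 0 * (R.drift k - 1))"
    by (metis (no_types, lifting) add_right_mono left_diff_distrib mult.commute norm_mult
        norm_triangle_ineq norm_triangle_ineq4 order_trans)
  also have "\<dots> \<le> (E / \<eta> * (4 / sqrt \<eta>)) * (3 * H) + (4 / sqrt \<eta>) * (10 * real n * \<kappa> * (3 * H + G))
      + cmod (g k) * cmod (A 0 0) * (2 * real n * \<kappa>)"
  proof (intro add_mono)
    show "cmod (vinner n w (B 0)) \<le> (E / \<eta> * (4 / sqrt \<eta>)) * (3 * H)"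
      by (rule order_trans[OF vinner_bound mult_mono[OF w_norm B0]]) (use E \<eta> in auto)
    have "10 * real n * \<kappa> * (vnorm n (B 0) + G) \<le> 10 * real n * \<kappa> * (3 * H + G)"
      using B0 \<kappa> by (intro mult_left_mono) auto
    then have "vnorm n R.resid \<le> 10 * real n * \<kappa> * (3 * H + G)"
      using R.resid_norm[OF n] by (simp add: G_def)
    from mult_mono[OF u_norm this]
    show "cmod (vinner n u R.resid) \<le> (4 / sqrt \<eta>) * (10 * real n * \<kappa> * (3 * H + G))"
      using vinner_bound[of n u R.resid] \<eta> by simp
    show "cmod (g k * A 0 0 * (R.drift k - 1)) \<le> cmod (g k) * cmod (A 0 0) * (2 * real n * \<kappa>)"
      unfolding norm_mult by (intro mult_left_mono R.drift_bound[OF k]) auto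
  qed
  \<comment> \<open>Every term receives the factor \<open>cmod (A 0 0)\<close>, to be cancelled at
    the end; \<open>inv\<close> trades \<open>1 / sqrt \<eta>\<close> for it at the price of
    \<open>1 / \<eta>\<close>. Here 216 is 18 * 4 * 3 and 40 is 4 * 10.\<close>
  also have "\<dots> \<le> cmod (A 0 0) * (216 * N * H) + cmod (A 0 0) * (40 * N * (3 * H + G)) + cmod (A 0 0) * (2 * N * G)"
  proof (intro add_mono)
    have inv: "1 / sqrt \<eta> \<le> cmod (A 0 0) * (1 / \<eta>)"
    proof -
      have "1 / sqrt \<eta> = sqrt \<eta> / \<eta>" using \<eta>s \<eta> by (simp add: frac_eq_eq)
      also have "\<dots> \<le> cmod (A 0 0) / \<eta>" using A0 \<eta> by (intro divide_right_mono) auto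
      finally show ?thesis by simp
    qed
    have "(E / \<eta> * (4 / sqrt \<eta>)) * (3 * H) = (12 * E * H / \<eta>) * (1 / sqrt \<eta>)" by simp
    also have "\<dots> \<le> (12 * E * H / \<eta>) * (cmod (A 0 0) * (1 / \<eta>))"
      using inv E \<eta> GH by (intro mult_left_mono) auto
    also have "\<dots> = cmod (A 0 0) * (216 * N * H)" by (simp add: E_def N_def power2_eq_square)
    finally show "(E / \<eta> * (4 / sqrt \<eta>)) * (3 * H) \<le> cmod (A 0 0) * (216 * N * H)" .
    have nN: "real n * \<kappa> / \<eta> \<le> N"
      unfolding N_def using \<eta>2 n1 \<kappa> \<eta> by (intro frac_le mult_right_mono) auto
    have nN': "real n * \<kappa> \<le> N"
      using frac_le[of "(real n)\<^sup>2 * \<kappa>" "(real n)\<^sup>2 * \<kappa>" "\<eta>\<^sup>2" 1] mult_right_mono[OF n1 \<kappa>] \<kappa> \<eta>2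
      by (simp add: N_def)
    have "(4 / sqrt \<eta>) * (10 * real n * \<kappa> * (3 * H + G)) = (40 * real n * \<kappa> * (3 * H + G)) * (1 / sqrt \<eta>)" by simp
    also have "\<dots> \<le> (40 * real n * \<kappa> * (3 * H + G)) * (cmod (A 0 0) * (1 / \<eta>))"
      using inv \<kappa> GH by (intro mult_left_mono) auto
    also have "\<dots> = (40 * (3 * H + G) * cmod (A 0 0)) * (real n * \<kappa> / \<eta>)" by simp
    also have "\<dots> \<le> (40 * (3 * H + G) * cmod (A 0 0)) * N"
      using nN GH by (intro mult_left_mono) auto
    finally show "(4 / sqrt \<eta>) * (10 * real n * \<kappa> * (3 * H + G)) \<le> cmod (A 0 0) * (40 * N * (3 * H + G))"
      by (simp add: mult_ac)
    have gk: "cmod (g k) \<le> G" unfolding G_def using k by (intro member_le_sum) auto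
    have "cmod (g k) * cmod (A 0 0) * (2 * real n * \<kappa>) = cmod (A 0 0) * (2 * (cmod (g k) * (real n * \<kappa>)))" by simp
    also have "\<dots> \<le> cmod (A 0 0) * (2 * (G * N))"
      using gk nN' GH \<kappa> by (intro mult_left_mono mult_mono) auto
    finally show "cmod (g k) * cmod (A 0 0) * (2 * real n * \<kappa>) \<le> cmod (A 0 0) * (2 * N * G)"
      by (simp add: mult_ac)
  qed
  also have "\<dots> = cmod (A 0 0) * (N * (336 * H + 42 * G))" by (simp add: algebra_simps)
  also have "\<dots> \<le> cmod (A 0 0) * (N * (400 * (H + G)))"
    using GH \<kappa> \<eta> by (intro mult_left_mono) (auto simp: N_def)
  finally have "cmod (g k - h k) \<le> N * (400 * (H + G))"
    using R.A00 by (simp add: mult_le_cancel_left)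
  then show ?thesis by (simp add: N_def G_def H_def mult_ac)
qed

section \<open>Coercivity of the Gram form\<close>

text \<open>Cauchy's formula at the centre: on the unit circle the derivative of the path is 2 pi i
  times the point, which cancels the kernel.\<close>

lemma circle_mean_value:
  assumes "continuous_on (cball 0 1) F" "F holomorphic_on ball 0 1"
  shows "((\<lambda>t. F (circlepath 0 1 t)) has_integral F 0) {0..1}"
proof -
  have "((\<lambda>u. F u / (u - 0)) has_contour_integral 2 * of_real pi * \<i> * F 0) (circlepath 0 1)"
    by (rule Cauchy_integral_circlepath) (use assms in auto)
  then have "((\<lambda>t. F (circlepath 0 1 t) / (circlepath 0 1 t - 0) *
       vector_derivative (circlepath 0 1) (at t within {0..1})) has_integral 2 * of_real pi * \<i> * F 0) {0..1}"
    by (simp add: has_contour_integral_def)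
  then have "((\<lambda>t. (2 * of_real pi * \<i>) * F (circlepath 0 1 t)) has_integral 2 * of_real pi * \<i> * F 0) {0..1}"
  proof (rule has_integral_eq[rotated])
    fix t :: real assume "t \<in> {0..1}"
    then have "vector_derivative (circlepath 0 1) (at t within {0..1}) = 2 * of_real pi * \<i> * circlepath 0 1 t"
      by (simp add: vector_derivative_circlepath01) (simp add: circlepath)
    moreover have "circlepath 0 1 t \<noteq> 0" by (simp add: circlepath)
    ultimately show "F (circlepath 0 1 t) / (circlepath 0 1 t - 0) *
        vector_derivative (circlepath 0 1) (at t within {0..1}) = (2 * of_real pi * \<i>) * F (circlepath 0 1 t)"
      by simp
  qed
  from has_integral_mult_right[OF this, of "1 / (2 * of_real pi * \<i>)"] show ?thesis by simp
qed

definition peval :: "nat \<Rightarrow> (nat \<Rightarrow> complex) \<Rightarrow> complex \<Rightarrow> complex" where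
  "peval n x z = (\<Sum>i<n. x i * z ^ i)"

lemma peval_continuous: "continuous_on S (peval n x)"
  unfolding peval_def by (intro continuous_intros)

lemma peval_holomorphic: "peval n x holomorphic_on S"
  unfolding peval_def by (intro holomorphic_intros)

text \<open>On the unit circle, \<open>corr_tail\<close> collects the strictly positive Fourier modes of \<open>cnj x * a\<close>, and
  the conjugate of \<open>corr\<close> the remaining ones.\<close>
definition corr :: "nat \<Rightarrow> (nat \<Rightarrow> complex) \<Rightarrow> (nat \<Rightarrow> complex) \<Rightarrow> nat \<Rightarrow> complex" where
  "corr n a x j = vinner n (shift_down j a) x"

definition corr_tail :: "nat \<Rightarrow> (nat \<Rightarrow> complex) \<Rightarrow> (nat \<Rightarrow> complex) \<Rightarrow> complex \<Rightarrow> complex" where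
  "corr_tail n a x z = (\<Sum>i<n. \<Sum>m<n. if i < m then cnj (x i) * a m * z ^ (m - i) else 0)"

lemma corr_tail_continuous: "continuous_on S (corr_tail n a x)"
proof -
  have "continuous_on S (\<lambda>z. if i < m then cnj (x i) * a m * z ^ (m - i) else 0)" for i m
    by (cases "i < m") (auto intro!: continuous_intros)
  then show ?thesis unfolding corr_tail_def by (intro continuous_on_sum)
qed

lemma corr_tail_holomorphic: "corr_tail n a x holomorphic_on S"
proof -
  have "(\<lambda>z. if i < m then cnj (x i) * a m * z ^ (m - i) else 0) holomorphic_on S" for i m
    by (cases "i < m") (auto intro!: holomorphic_intros)
  then show ?thesis unfolding corr_tail_def by (intro holomorphic_on_sum)
qed

lemma corr_tail_0: "corr_tail n a x 0 = 0"
  unfolding corr_tail_def by (intro sum.neutral ballI) auto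

text \<open>On the circle \<open>cnj z\<close> inverts \<open>z\<close>, so the term with indices i,
  m has frequency m - i; the two parts separate its signs.\<close>

lemma corr_decomp:
  assumes z: "cmod z = 1"
  shows "cnj (peval n x z) * peval n a z = cnj (peval n (corr n a x) z) + corr_tail n a x z"
proof -
  have zz: "cnj z * z = 1" using z by (metis complex_norm_square mult.commute of_real_1 power_one)
  have summand: "cnj (x i) * cnj z ^ i * (a m * z ^ m) =
      (if i < m then cnj (x i) * a m * z ^ (m - i) else 0)
      + (if m \<le> i then cnj (x i) * a m * cnj z ^ (i - m) else 0)" for i m
  proof -
    have ac: "cnj (x i) * cnj z ^ i * (a m * z ^ m) = cnj (x i) * a m * (cnj z ^ i * z ^ m)" by simp
    show ?thesis
    proof (cases "i < m")
      case True
      then have "z ^ m = z ^ i * z ^ (m - i)" by (simp add: power_add[symmetric])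
      then have "cnj z ^ i * z ^ m = (cnj z * z) ^ i * z ^ (m - i)" by (simp add: power_mult_distrib)
      then show ?thesis using True unfolding ac zz by simp
    next
      case False
      then have "cnj z ^ i = cnj z ^ m * cnj z ^ (i - m)" by (simp add: power_add[symmetric])
      then have "cnj z ^ i * z ^ m = (cnj z * z) ^ m * cnj z ^ (i - m)" by (simp add: power_mult_distrib)
      then show ?thesis using False unfolding ac zz by simp
    qed
  qed
  have "cnj (peval n x z) * peval n a z = (\<Sum>i<n. \<Sum>m<n. cnj (x i) * cnj z ^ i * (a m * z ^ m))"
    by (simp add: peval_def sum_product)
  also have "\<dots> = corr_tail n a x z + (\<Sum>i<n. \<Sum>m<n. if m \<le> i then cnj (x i) * a m * cnj z ^ (i - m) else 0)"
    unfolding summand corr_tail_def by (simp add: sum.distrib)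
  also have "(\<Sum>i<n. \<Sum>m<n. if m \<le> i then cnj (x i) * a m * cnj z ^ (i - m) else 0)
      = (\<Sum>i<n. \<Sum>j<n. if j \<le> i then cnj (x i) * a (i - j) * cnj z ^ j else 0)"
  proof (rule sum.cong[OF refl])
    fix i assume i: "i \<in> {..<n}"
    have "(\<Sum>m<n. if m \<le> i then cnj (x i) * a m * cnj z ^ (i - m) else 0)
        = (\<Sum>m\<le>i. cnj (x i) * a m * cnj z ^ (i - m))"
      using i by (intro sum.mono_neutral_cong_right) auto
    also have "\<dots> = (\<Sum>j\<le>i. cnj (x i) * a (i - j) * cnj z ^ j)"
      by (rule sum.reindex_bij_witness[of _ "\<lambda>j. i - j" "\<lambda>j. i - j"]) auto
    also have "\<dots> = (\<Sum>j<n. if j \<le> i then cnj (x i) * a (i - j) * cnj z ^ j else 0)"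
      using i by (intro sum.mono_neutral_cong_left) auto
    finally show "(\<Sum>m<n. if m \<le> i then cnj (x i) * a m * cnj z ^ (i - m) else 0)
        = (\<Sum>j<n. if j \<le> i then cnj (x i) * a (i - j) * cnj z ^ j else 0)" .
  qed
  also have "\<dots> = (\<Sum>j<n. \<Sum>i<n. if j \<le> i then cnj (x i) * a (i - j) * cnj z ^ j else 0)"
    by (rule sum.swap)
  also have "\<dots> = (\<Sum>j<n. cnj (corr n a x j) * cnj z ^ j)"
  proof (rule sum.cong[OF refl])
    fix j
    show "(\<Sum>i<n. if j \<le> i then cnj (x i) * a (i - j) * cnj z ^ j else 0) = cnj (corr n a x j) * cnj z ^ j"
      unfolding corr_def vinner_def cnj_sum sum_distrib_right
      by (intro sum.cong) (auto simp: shift_down_def)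
  qed
  also have "\<dots> = cnj (peval n (corr n a x) z)" by (simp add: peval_def)
  finally show ?thesis by simp
qed

lemma norm_circlepath_0_1: "cmod (circlepath 0 1 t) = 1"
  by (simp add: circlepath)

text \<open>\<open>corr_decomp\<close> with \<open>a = x\<close>: the tail has mean 0, and the other
  part has as its mean the constant term \<open>corr n x x 0\<close>, the squared norm.\<close>

lemma circle_parseval:
  "((\<lambda>t. (cmod (peval n x (circlepath 0 1 t)))\<^sup>2) has_integral (vnorm n x)\<^sup>2) {0..1}"
proof (cases "n = 0")
  case True
  then show ?thesis by (simp add: peval_def vnorm_def)
next
  case False
  have c0: "peval n (corr n x x) 0 = (vnorm n x)\<^sup>2"
  proof -
    have "peval n (corr n x x) 0 = (\<Sum>i<n. if i = 0 then corr n x x 0 else 0)"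
      unfolding peval_def by (intro sum.cong) (auto simp: power_0_left)
    also have "\<dots> = vinner n (shift_down 0 x) x" using False by (simp add: corr_def)
    also have "\<dots> = vinner n x x" by (rule vinner_cong) (auto simp: shift_down_def)
    finally show ?thesis by (simp add: vinner_self)
  qed
  have "((\<lambda>t. peval n (corr n x x) (circlepath 0 1 t)) has_integral peval n (corr n x x) 0) {0..1}"
    by (rule circle_mean_value[OF peval_continuous peval_holomorphic])
  then have "((\<lambda>t. cnj (peval n (corr n x x) (circlepath 0 1 t))) has_integral cnj (peval n (corr n x x) 0)) {0..1}"
    using has_integral_cnj[of "\<lambda>t. peval n (corr n x x) (circlepath 0 1 t)"] by (simp add: o_def)
  moreover have "((\<lambda>t. corr_tail n x x (circlepath 0 1 t)) has_integral corr_tail n x x 0) {0..1}"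
    by (rule circle_mean_value[OF corr_tail_continuous corr_tail_holomorphic])
  ultimately have "((\<lambda>t. cnj (peval n x (circlepath 0 1 t)) * peval n x (circlepath 0 1 t)) has_integral
      complex_of_real ((vnorm n x)\<^sup>2)) {0..1}"
    unfolding corr_decomp[OF norm_circlepath_0_1] c0 corr_tail_0
    by (metis has_integral_add add.right_neutral complex_cnj_complex_of_real)
  from has_integral_Re[OF this] show ?thesis
    by (simp add: cmod_power2) (simp add: power2_eq_square)
qed

text \<open>Dividing \<open>corr_decomp\<close> by \<open>a\<close> gives \<open>|x|\<^sup>2 = cnj y * x / a + (tail) * x / a\<close> on the circle, and the last
  summand is analytic with a zero at the origin, so its mean vanishes.\<close>
lemma corr_lower_bound:
  assumes nz: "\<And>z. cmod z < 1 \<Longrightarrow> peval n a z \<noteq> 0" and \<eta>: "0 < \<eta>"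
    and circ: "\<And>z. cmod z = 1 \<Longrightarrow> \<eta> \<le> (cmod (peval n a z))\<^sup>2"
  shows "\<eta> * (vnorm n x)\<^sup>2 \<le> (vnorm n (corr n a x))\<^sup>2"
proof -
  let ?c = "circlepath 0 1"
  let ?X = "peval n x" and ?P = "peval n a" and ?Y = "peval n (corr n a x)" and ?Q = "corr_tail n a x"
  have P1: "?P z \<noteq> 0" if "cmod z = 1" for z using circ[OF that] \<eta> by auto
  have P: "?P z \<noteq> 0" if "cmod z \<le> 1" for z using nz[of z] P1[of z] that by fastforce
  have tail: "((\<lambda>t. ?Q (?c t) * ?X (?c t) / ?P (?c t)) has_integral ?Q 0 * ?X 0 / ?P 0) {0..1}"
    using P by (intro circle_mean_value[where F = "\<lambda>z. ?Q z * ?X z / ?P z"] continuous_intros holomorphic_intros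
      peval_continuous corr_tail_continuous peval_holomorphic corr_tail_holomorphic) auto
  have main: "((\<lambda>t. Re (cnj (?X (?c t)) * ?X (?c t) - ?Q (?c t) * ?X (?c t) / ?P (?c t)))
      has_integral (vnorm n x)\<^sup>2 - 0) {0..1}"
    using has_integral_diff[OF circle_parseval[of n x] has_integral_Re[OF tail]]
    by (simp add: corr_tail_0 cmod_power2) (simp add: power2_eq_square)
  \<comment> \<open>The arithmetic-geometric mean of |X| and |Y / P|: half of |X|^2 will be absorbed
    on the left, and \<open>circ\<close> replaces |P|^2 by \<eta>.\<close>
  have maj: "((\<lambda>t. (cmod (?X (?c t)))\<^sup>2 * (1/2) + (cmod (?Y (?c t)))\<^sup>2 * (1 / (2 * \<eta>))) has_integral
      (vnorm n x)\<^sup>2 * (1/2) + (vnorm n (corr n a x))\<^sup>2 * (1 / (2 * \<eta>))) {0..1}"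
    by (intro has_integral_add has_integral_mult_left circle_parseval)
  have "(vnorm n x)\<^sup>2 - 0 \<le> (vnorm n x)\<^sup>2 * (1/2) + (vnorm n (corr n a x))\<^sup>2 * (1 / (2 * \<eta>))"
  proof (rule has_integral_le[OF main maj])
    fix t :: real
    define z where "z = ?c t"
    have z: "cmod z = 1" unfolding z_def by (rule norm_circlepath_0_1)
    have p: "0 < cmod (?P z)" using P1[OF z] by simp
    have "cnj (?X z) * ?X z - ?Q z * ?X z / ?P z = (cnj (?X z) * ?P z - ?Q z) * ?X z / ?P z"
      using P1[OF z] by (simp add: field_simps)
    also have "\<dots> = cnj (?Y z) * ?X z / ?P z" unfolding corr_decomp[OF z, of n x a] by simp
    finally have "Re (cnj (?X z) * ?X z - ?Q z * ?X z / ?P z) \<le> cmod (?X z) * (cmod (?Y z) / cmod (?P z))"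
      by (metis complex_Re_le_cmod norm_mult norm_divide complex_mod_cnj mult.commute times_divide_eq_right)
    also have "\<dots> \<le> (cmod (?X z))\<^sup>2 * (1/2) + (cmod (?Y z) / cmod (?P z))\<^sup>2 * (1/2)"
      using sum_squares_bound[of "cmod (?X z)" "cmod (?Y z) / cmod (?P z)"] by simp
    also have "(cmod (?Y z) / cmod (?P z))\<^sup>2 \<le> (cmod (?Y z))\<^sup>2 / \<eta>"
      unfolding power_divide using circ[OF z] \<eta> p by (intro divide_left_mono) simp_all
    finally show "Re (cnj (?X (?c t)) * ?X (?c t) - ?Q (?c t) * ?X (?c t) / ?P (?c t))
        \<le> (cmod (?X (?c t)))\<^sup>2 * (1/2) + (cmod (?Y (?c t)))\<^sup>2 * (1 / (2 * \<eta>))"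
      by (simp add: z_def)
  qed
  then show ?thesis using \<eta> by (simp add: field_simps)
qed

text \<open>\<open>corr n a x\<close> is T(a)^H x, so on the diagonal the Gram form is a sum of two
  squared norms, and \<open>corr_lower_bound\<close> handles the first.\<close>

lemma gram_form_coercive:
  assumes nz: "\<And>z. cmod z < 1 \<Longrightarrow> peval n a z \<noteq> 0" and \<eta>: "0 < \<eta>"
    and circ: "\<And>z. cmod z = 1 \<Longrightarrow> \<eta> \<le> (cmod (peval n a z))\<^sup>2"
  shows "\<eta> * (vnorm n x)\<^sup>2 \<le> cmod (gram_form n a b x x)"
proof -
  have "gram_form n a b x x = complex_of_real ((vnorm n (corr n a x))\<^sup>2 + (vnorm n (corr n b x))\<^sup>2)"
    unfolding gram_form_def outer_form_self vnorm_sq corr_def by (simp add: sum.distrib)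
  then have "cmod (gram_form n a b x x) = (vnorm n (corr n a x))\<^sup>2 + (vnorm n (corr n b x))\<^sup>2"
    by (simp only: norm_of_real) simp
  then show ?thesis using corr_lower_bound[OF assms, of x] zero_le_power2[of "vnorm n (corr n b x)"] by linarith
qed

text \<open>\<open>corr_lower_bound\<close> at the first unit vector, which T(a)^H multiplies by
  \<open>cnj (a 0)\<close>.\<close>

lemma constant_term_lower_bound:
  assumes nz: "\<And>z. cmod z < 1 \<Longrightarrow> peval n a z \<noteq> 0" and \<eta>: "0 < \<eta>"
    and circ: "\<And>z. cmod z = 1 \<Longrightarrow> \<eta> \<le> (cmod (peval n a z))\<^sup>2" and n: "0 < n"
  shows "sqrt \<eta> \<le> cmod (a 0)"
proof -
  define x :: "nat \<Rightarrow> complex" where "x = (\<lambda>i. if i = 0 then 1 else 0)"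
  have "(vnorm n x)\<^sup>2 = (\<Sum>i<n. if i = 0 then 1 else 0)"
    unfolding vnorm_sq x_def by (intro sum.cong) auto
  then have x: "(vnorm n x)\<^sup>2 = 1" using n by simp
  have "corr n a x j = (if j = 0 then cnj (a 0) else 0)" for j
  proof -
    have "corr n a x j = (\<Sum>i<n. if i = 0 then cnj (shift_down j a 0) else 0)"
      unfolding corr_def vinner_def x_def by (intro sum.cong) auto
    then show ?thesis using n by (simp add: shift_down_def)
  qed
  then have "(vnorm n (corr n a x))\<^sup>2 = (\<Sum>j<n. if j = 0 then (cmod (a 0))\<^sup>2 else 0)"
    unfolding vnorm_sq by (intro sum.cong) auto
  then have "(vnorm n (corr n a x))\<^sup>2 = (cmod (a 0))\<^sup>2" using n by simp
  then have "\<eta> \<le> (cmod (a 0))\<^sup>2" using corr_lower_bound[OF nz \<eta> circ, of x] x by simp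
  then show ?thesis using real_sqrt_le_mono[of \<eta> "(cmod (a 0))\<^sup>2"] by simp
qed

section \<open>The exact recursion of the NLFT\<close>

text \<open>The second column of an NLFT product determines the whole \<open>SU(2)\<close> matrix and obeys its own recursion.\<close>
fun nlft_col :: "(int \<Rightarrow> complex) \<Rightarrow> int list \<Rightarrow> lpoly \<times> lpoly" where
  "nlft_col \<gamma> [] = ((\<lambda>_. 0), lconst 1)"
| "nlft_col \<gamma> (k # ks) =
    ((\<lambda>j. rot_scale (\<gamma> k) * (fst (nlft_col \<gamma> ks) j + \<gamma> k * snd (nlft_col \<gamma> ks) (j - k))),
     (\<lambda>j. rot_scale (\<gamma> k) * (snd (nlft_col \<gamma> ks) j - cnj (\<gamma> k) * fst (nlft_col \<gamma> ks) (j + k))))"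

lemma lmult_lmono: "lmult (lmono c m) q = (\<lambda>j. c * q (j - m))"
proof (cases "c = 0")
  case False
  then have "{j. lmono c m j \<noteq> 0} = {m}" by (auto simp: lmono_def)
  then show ?thesis by (simp add: lmult_def lmono_def)
qed (simp add: lmult_def lmono_def)

lemma lmult_lconst: "lmult (lconst c) q = (\<lambda>j. c * q j)"
  using lmult_lmono[of c 0 q] by (simp add: lmono_def lconst_def)

lemma nlft_foldr_eq_col:
  "foldr (\<lambda>k M. mmul (nlft_factor (\<gamma> k) k) M) ks mid
     = (lstar (snd (nlft_col \<gamma> ks)), fst (nlft_col \<gamma> ks), (\<lambda>j. - lstar (fst (nlft_col \<gamma> ks)) j), snd (nlft_col \<gamma> ks))"
proof (induction ks)
  case Nil
  then show ?case by (auto simp: mid_def lstar_def lconst_def fun_eq_iff)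
next
  case (Cons k ks)
  then show ?case
    by (auto simp: mmul_def nlft_factor_def Let_def lmult_lmono lmult_lconst ladd_def rot_scale_def[symmetric]
        lstar_def fun_eq_iff algebra_simps)
qed

text \<open>Zero coefficients contribute the identity, as \<open>rot_scale 0 = 1\<close>. The
  product over the support can thus be taken over an interval, from which indices are peeled one at
  a time.\<close>

lemma nlft_col_filter: "nlft_col \<gamma> (filter (\<lambda>k. \<gamma> k \<noteq> 0) ks) = nlft_col \<gamma> ks"
  by (induction ks) (auto simp: rot_scale_def)

lemma nlft_eq_col:
  assumes "{k. \<gamma> k \<noteq> 0} \<subseteq> {lo..hi}"
  shows "nlft \<gamma> = (lstar (snd (nlft_col \<gamma> [lo..hi])), fst (nlft_col \<gamma> [lo..hi]))"
proof -
  have "{k. \<gamma> k \<noteq> 0} = set (filter (\<lambda>k. \<gamma> k \<noteq> 0) [lo..hi])" using assms by auto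
  then have "sorted_list_of_set {k. \<gamma> k \<noteq> 0} = filter (\<lambda>k. \<gamma> k \<noteq> 0) [lo..hi]"
    using sorted_list_of_set.idem_if_sorted_distinct[of "filter (\<lambda>k. \<gamma> k \<noteq> 0) [lo..hi]"]
    by (simp add: sorted_wrt_filter)
  then show ?thesis by (simp add: nlft_def nlft_mat_def nlft_foldr_eq_col nlft_col_filter)
qed

text \<open>One induction for all claims, because the step of each component reads the support of
  both. At the left end only \<open>\<gamma> lo * p 0\<close> contributes, at the right end of a
  longer interval only \<open>q hi\<close>. The \<open>max 0\<close> covers the empty
  interval.\<close>

lemma nlft_col_upto:
  "(\<forall>j. fst (nlft_col \<gamma> [lo..hi]) j \<noteq> 0 \<longrightarrow> lo \<le> j \<and> j \<le> hi)
   \<and> (\<forall>j. snd (nlft_col \<gamma> [lo..hi]) j \<noteq> 0 \<longrightarrow> 0 \<le> j \<and> j \<le> max 0 (hi - lo))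
   \<and> snd (nlft_col \<gamma> [lo..hi]) 0 \<noteq> 0
   \<and> (lo \<le> hi \<longrightarrow> \<gamma> lo \<noteq> 0 \<longrightarrow> fst (nlft_col \<gamma> [lo..hi]) lo \<noteq> 0)
   \<and> (lo \<le> hi \<longrightarrow> \<gamma> hi \<noteq> 0 \<longrightarrow> fst (nlft_col \<gamma> [lo..hi]) hi \<noteq> 0)"
proof (induction lo hi rule: upto.induct)
  case (1 lo hi)
  show ?case
  proof (cases "lo \<le> hi")
    case False
    then show ?thesis by (auto simp: lconst_def split: if_splits)
  next
    case True
    define q where "q = fst (nlft_col \<gamma> [lo + 1..hi])"
    define p where "p = snd (nlft_col \<gamma> [lo + 1..hi])"
    note IH = 1[OF True, folded q_def p_def]
    have q': "\<And>j. q j \<noteq> 0 \<Longrightarrow> lo + 1 \<le> j \<and> j \<le> hi"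
      and p': "\<And>j. p j \<noteq> 0 \<Longrightarrow> 0 \<le> j \<and> j \<le> max 0 (hi - (lo + 1))"
      and p0: "p 0 \<noteq> 0" and qhi': "lo + 1 \<le> hi \<Longrightarrow> \<gamma> hi \<noteq> 0 \<Longrightarrow> q hi \<noteq> 0"
      using IH by blast+
    have q: "q j = 0" if "j < lo + 1 \<or> hi < j" for j using q'[of j] that by linarith
    have p: "p j = 0" if "j < 0 \<or> max 0 (hi - (lo + 1)) < j" for j using p'[of j] that by linarith
    have qhi: "q hi \<noteq> 0" if "lo < hi" "\<gamma> hi \<noteq> 0" using qhi' that by simp
    have s: "rot_scale (\<gamma> lo) \<noteq> 0" using rot_scale_pos[of "\<gamma> lo"] by simp
    have F: "fst (nlft_col \<gamma> [lo..hi]) = (\<lambda>j. rot_scale (\<gamma> lo) * (q j + \<gamma> lo * p (j - lo)))"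
      and S: "snd (nlft_col \<gamma> [lo..hi]) = (\<lambda>j. rot_scale (\<gamma> lo) * (p j - cnj (\<gamma> lo) * q (j + lo)))"
      using True by (simp_all add: upto.simps[of lo hi] q_def p_def)
    show ?thesis
    proof (intro conjI allI impI)
      fix j assume "fst (nlft_col \<gamma> [lo..hi]) j \<noteq> 0"
      then have "q j \<noteq> 0 \<or> p (j - lo) \<noteq> 0" by (auto simp: F)
      then show "lo \<le> j" "j \<le> hi" using q[of j] p[of "j - lo"] True by linarith+
    next
      fix j assume "snd (nlft_col \<gamma> [lo..hi]) j \<noteq> 0"
      then have "p j \<noteq> 0 \<or> q (j + lo) \<noteq> 0" by (auto simp: S)
      then show "0 \<le> j" "j \<le> max 0 (hi - lo)" using q[of "j + lo"] p[of j] True by linarith+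
    next
      show "snd (nlft_col \<gamma> [lo..hi]) 0 \<noteq> 0" using s p0 q[of lo] by (simp add: S)
    next
      assume "\<gamma> lo \<noteq> 0"
      then show "fst (nlft_col \<gamma> [lo..hi]) lo \<noteq> 0" using s p0 q[of lo] by (simp add: F)
    next
      assume h: "\<gamma> hi \<noteq> 0"
      show "fst (nlft_col \<gamma> [lo..hi]) hi \<noteq> 0"
      proof (cases "lo = hi")
        case True
        then show ?thesis using s h by (simp add: lconst_def)
      next
        case False
        then show ?thesis using s qhi h p[of "hi - lo"] \<open>lo \<le> hi\<close> by (simp add: F)
      qed
    qed
  qed
qed

lemma nlft_col_fst_support: "j < lo \<or> hi < j \<Longrightarrow> fst (nlft_col \<gamma> [lo..hi]) j = 0"
  and nlft_col_snd_support: "j < 0 \<or> max 0 (hi - lo) < j \<Longrightarrow> snd (nlft_col \<gamma> [lo..hi]) j = 0"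
  and nlft_col_snd_0: "snd (nlft_col \<gamma> [lo..hi]) 0 \<noteq> 0"
  and nlft_col_fst_lo: "lo \<le> hi \<Longrightarrow> \<gamma> lo \<noteq> 0 \<Longrightarrow> fst (nlft_col \<gamma> [lo..hi]) lo \<noteq> 0"
  and nlft_col_fst_hi: "lo \<le> hi \<Longrightarrow> \<gamma> hi \<noteq> 0 \<Longrightarrow> fst (nlft_col \<gamma> [lo..hi]) hi \<noteq> 0"
  using nlft_col_upto[of \<gamma> lo hi] by (meson leD)+

text \<open>The extreme indices of the support of \<gamma> carry nonzero coefficients of b, so they
  lie in the degree range of b.\<close>

lemma nlft_support:
  assumes fin: "finite {k. \<gamma> k \<noteq> 0}" and nlft: "nlft \<gamma> = (a, b)"
    and lo: "\<And>k. k < 0 \<Longrightarrow> b k = 0" and hi: "\<And>k. m < k \<Longrightarrow> b k = 0"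
  shows "{k. \<gamma> k \<noteq> 0} \<subseteq> {0..m}"
proof (cases "{k. \<gamma> k \<noteq> 0} = {}")
  case False
  let ?S = "{k. \<gamma> k \<noteq> 0}"
  have mm: "Min ?S \<in> ?S" "Max ?S \<in> ?S" using fin False by (auto intro: Min_in Max_in simp del: mem_Collect_eq)
  have sub: "?S \<subseteq> {Min ?S..Max ?S}" using fin by auto
  then have "b = fst (nlft_col \<gamma> [Min ?S..Max ?S])" using nlft nlft_eq_col[OF sub] by simp
  moreover have "Min ?S \<le> Max ?S" using mm fin by simp
  ultimately have "b (Min ?S) \<noteq> 0" "b (Max ?S) \<noteq> 0"
    using nlft_col_fst_lo[of "Min ?S" "Max ?S" \<gamma>] nlft_col_fst_hi[of "Min ?S" "Max ?S" \<gamma>] mm by simp_all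
  then have "0 \<le> Min ?S" "Max ?S \<le> m" using lo hi by (meson not_le)+
  then show ?thesis using sub by (meson atLeastatMost_subset_iff order_trans)
qed simp

text \<open>The exact states are the partial products over \<open>[int k..int n - 1]\<close>: a step
  of layer stripping multiplies by the inverse of the leftmost factor and so undoes one step of
  \<open>nlft_col\<close>. The offset \<open>int i - int k\<close> is the padding by zeros.\<close>

lemma nlft_exact_run:
  fixes \<gamma> :: "int \<Rightarrow> complex" and n :: nat
  defines "c \<equiv> \<lambda>k. nlft_col \<gamma> [int k..int n - 1]"
  assumes start: "(vnorm n (\<lambda>i. snd (c 0) (int i)))\<^sup>2 + (vnorm n (\<lambda>i. fst (c 0) (int i)))\<^sup>2 \<le> 1"
  shows "layer_run n 0 (\<lambda>k. \<gamma> (int k)) (\<lambda>k i. snd (c k) (int i - int k)) (\<lambda>k i. fst (c k) (int i))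
      (\<lambda>k i. snd (c (Suc k)) (int i - int k))"
proof -
  have F0: "fst (c k) j = 0" if "j < int k" for k j
    unfolding c_def using that by (intro nlft_col_fst_support) simp
  have S0: "snd (c k) j = 0" if "j < 0" for k j
    unfolding c_def using that by (intro nlft_col_snd_support) simp
  have F: "fst (c k) j = rot_scale (\<gamma> (int k)) * (fst (c (Suc k)) j + \<gamma> (int k) * snd (c (Suc k)) (j - int k))"
    and S: "snd (c k) j = rot_scale (\<gamma> (int k)) * (snd (c (Suc k)) j - cnj (\<gamma> (int k)) * fst (c (Suc k)) (j + int k))"
    if "k < n" for k j
    using that unfolding c_def by (simp_all add: upto.simps[of "int k" "int n - 1"] add.commute)
  have sq: "complex_of_real (rot_scale g) * rot_scale g * (1 + g * cnj g) = 1" for g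
    using arg_cong[OF rot_scale_sq[of g], of complex_of_real]
    unfolding of_real_mult of_real_add complex_norm_square by (simp add: power2_eq_square)
  show ?thesis
  proof
    fix k i assume k: "k < n"
    let ?g = "\<gamma> (int k)"
    have "rot_scale ?g * (snd (c k) (int i - int k) + cnj ?g * fst (c k) (int i))
       = (complex_of_real (rot_scale ?g) * rot_scale ?g * (1 + ?g * cnj ?g)) * snd (c (Suc k)) (int i - int k)"
      unfolding F[OF k] S[OF k] by (simp add: algebra_simps)
    then show "cmod (snd (c (Suc k)) (int i - int k) - rot_scale ?g * (snd (c k) (int i - int k) + cnj ?g * fst (c k) (int i)))
       \<le> 0 * rot_scale ?g * (cmod (snd (c k) (int i - int k)) + cmod ?g * cmod (fst (c k) (int i)))"
      unfolding sq by simp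
    have "rot_scale ?g * (fst (c k) (int i) - ?g * snd (c k) (int i - int k))
       = (complex_of_real (rot_scale ?g) * rot_scale ?g * (1 + ?g * cnj ?g)) * fst (c (Suc k)) (int i)"
      unfolding F[OF k] S[OF k] by (simp add: algebra_simps)
    then show "cmod (fst (c (Suc k)) (int i) - rot_scale ?g * (fst (c k) (int i) - ?g * snd (c k) (int i - int k)))
       \<le> 0 * rot_scale ?g * (cmod (fst (c k) (int i)) + cmod ?g * cmod (snd (c k) (int i - int k)))"
      unfolding sq by simp
    show "snd (c (Suc k)) (int i - int (Suc k)) = shift_down (Suc 0) (\<lambda>i. snd (c (Suc k)) (int i - int k)) i"
      using S0 by (auto simp: shift_down_def of_nat_diff algebra_simps)
  next
    show "snd (c (Suc k)) (int i - int k) = 0" if "i < k" for k i using S0 that by simp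
    show "fst (c n) (int i) = 0" if "i < n" for i using F0 that by simp
    \<comment> \<open>The pivot relation is exact because the remaining product has no coefficient
      at index k in its first component.\<close>
    show "cmod (rot_scale (\<gamma> (int k)) * snd (c (Suc k)) (int k - int k) - snd (c k) (int k - int k))
      \<le> 0 * cmod (snd (c k) (int k - int k))" if "k < n" for k
      using S[OF that, of 0] F0[of "int k" "Suc k"] by simp
    show "snd (c 0) (int 0 - int 0) \<noteq> 0" by (simp add: c_def nlft_col_snd_0)
  qed (use start in auto)
qed

section \<open>Rounding errors of one step\<close>

lemma norm_one_plus_prod:
  fixes x y :: complex
  assumes "cmod x \<le> p" "cmod y \<le> q"
  shows "cmod ((1 + x) * (1 + y) - 1) \<le> p + q + p * q"
proof -
  have "(1 + x) * (1 + y) - 1 = x + y + x * y" by (simp add: algebra_simps)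
  then have "cmod ((1 + x) * (1 + y) - 1) \<le> cmod x + cmod y + cmod x * cmod y"
    by (metis norm_triangle_ineq norm_triangle_mono norm_mult order_refl)
  also have "\<dots> \<le> p + q + p * q"
    using assms order_trans[OF norm_ge_zero assms(1)] by (intro add_mono mult_mono) auto
  finally show ?thesis .
qed

text \<open>One more rounding costs \<open>2 * \<epsilon>\<close>: one \<epsilon> for the new factor
  and one for the product of the errors, as \<open>p * \<epsilon> \<le> 1\<close>.\<close>

lemma rel_prod:
  fixes x y :: complex
  assumes "cmod x \<le> p * \<epsilon>" "cmod y \<le> \<epsilon>" "0 \<le> \<epsilon>" "p * \<epsilon> \<le> 1" "p + 2 = r"
  shows "\<exists>w. (1 + x) * (1 + y) = 1 + w \<and> cmod w \<le> r * \<epsilon>"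
proof (intro exI conjI)
  show "(1 + x) * (1 + y) = 1 + ((1 + x) * (1 + y) - 1)" by simp
  have "p * \<epsilon> * \<epsilon> \<le> 1 * \<epsilon>" using assms by (intro mult_right_mono) auto
  then show "cmod ((1 + x) * (1 + y) - 1) \<le> r * \<epsilon>"
    using norm_one_plus_prod[OF assms(1,2)] unfolding assms(5)[symmetric] by (simp add: algebra_simps)
qed

text \<open>From (s - 1)(s + 1) = w and Re s \<ge> 0, which makes |s + 1| at least 1. Perturbations
  are complex, so the argument of the root need not be real.\<close>

lemma csqrt_near_one: "cmod (csqrt (1 + w) - 1) \<le> cmod w"
proof -
  have "(csqrt (1 + w) - 1) * (csqrt (1 + w) + 1) = w"
    using power2_csqrt[of "1 + w"] by (simp add: algebra_simps power2_eq_square)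
  then have "cmod (csqrt (1 + w) - 1) * cmod (csqrt (1 + w) + 1) = cmod w"
    by (metis norm_mult)
  moreover have "1 \<le> cmod (csqrt (1 + w) + 1)"
    using complex_Re_le_cmod[of "csqrt (1 + w) + 1"] csqrt_principal[of "1 + w"]
    by (simp del: csqrt.simps) linarith
  ultimately show ?thesis
    by (metis mult_left_mono mult.right_neutral norm_ge_zero)
qed

lemma csqrt_scale:
  fixes r :: real
  assumes "0 < r"
  shows "csqrt (of_real r * w) = of_real (sqrt r) * csqrt w"
proof (rule csqrt_unique)
  show "(of_real (sqrt r) * csqrt w)\<^sup>2 = of_real r * w"
    using assms by (simp add: power_mult_distrib flip: of_real_power)
  show "0 < Re (of_real (sqrt r) * csqrt w) \<or> Re (of_real (sqrt r) * csqrt w) = 0 \<and> 0 \<le> Im (of_real (sqrt r) * csqrt w)"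
    using assms csqrt_principal[of w] by auto
qed

definition fl_scale :: "perturb \<Rightarrow> nat \<Rightarrow> complex \<Rightarrow> complex" where
  "fl_scale d k g = fl (1 / fl (csqrt (fl (1 + fl (g * cnj g) (d k 0 1)) (d k 0 2))) (d k 0 3)) (d k 0 4)"

text \<open>There is no cancellation in 1 + |g|^2, so the bound is independent of \<open>g\<close>.
  The error grows as 1, 3, 5 times \<epsilon> through the root, and the reciprocal gives 6 / 0.99,
  rounded up to 8.\<close>

lemma fl_scale_error:
  assumes d: "\<And>k j i. cmod (d k j i) \<le> \<epsilon>" and \<epsilon>: "\<epsilon> \<le> 1 / 1000"
  shows "\<exists>w :: complex. fl_scale d k g = rot_scale g * (1 + w) \<and> cmod w \<le> 8 * \<epsilon>"
proof -
  have \<epsilon>0: "0 \<le> \<epsilon>" using d[of 0 0 0] norm_ge_zero order_trans by blast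
  define r where "r = 1 + (cmod g)\<^sup>2"
  have r: "0 < r" by (simp add: r_def add_pos_nonneg)
  \<comment> \<open>The rounding error of |g|^2, taken relative to 1 + |g|^2.\<close>
  define x where "x = d k 0 1 * ((cmod g)\<^sup>2 / r)"
  have x: "cmod x \<le> 1 * \<epsilon>"
  proof -
    have "(cmod g)\<^sup>2 / r \<le> 1" using r by (simp add: r_def)
    then have "cmod (d k 0 1) * ((cmod g)\<^sup>2 / r) \<le> \<epsilon> * 1"
      using d \<epsilon>0 r by (intro mult_mono) auto
    then show ?thesis using r by (simp add: x_def norm_mult norm_divide norm_power)
  qed
  have x1: "1 + fl (g * cnj g) (d k 0 1) = r * (1 + x)"
  proof -
    have "complex_of_real r * x = complex_of_real ((cmod g)\<^sup>2) * d k 0 1"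
      using r by (simp add: x_def)
    then show ?thesis
      unfolding fl_def complex_norm_square[symmetric] by (simp add: r_def algebra_simps)
  qed
  have "\<exists>y. (1 + x) * (1 + d k 0 2) = 1 + y \<and> cmod y \<le> 3 * \<epsilon>"
    by (rule rel_prod[of x 1 \<epsilon> "d k 0 2" 3]) (use x d[of k 0 2] \<epsilon> \<epsilon>0 in auto)
  then obtain y where y: "(1 + x) * (1 + d k 0 2) = 1 + y" "cmod y \<le> 3 * \<epsilon>" by blast
  with x1 have t2: "fl (1 + fl (g * cnj g) (d k 0 1)) (d k 0 2) = r * (1 + y)"
    using y(1) by (simp add: fl_def mult.assoc)
  define v where "v = csqrt (1 + y) - 1"
  have v: "cmod v \<le> 3 * \<epsilon>" using csqrt_near_one[of y] y(2) by (simp add: v_def)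
  have "\<exists>t. (1 + v) * (1 + d k 0 3) = 1 + t \<and> cmod t \<le> 5 * \<epsilon>"
    by (rule rel_prod[of v 3 \<epsilon> "d k 0 3" 5]) (use v d[of k 0 3] \<epsilon> \<epsilon>0 in auto)
  then obtain t where t: "(1 + v) * (1 + d k 0 3) = 1 + t" "cmod t \<le> 5 * \<epsilon>" by blast
  have t3: "fl (csqrt (fl (1 + fl (g * cnj g) (d k 0 1)) (d k 0 2))) (d k 0 3) = sqrt r * (1 + t)"
    unfolding t2 csqrt_scale[OF r] t(1)[symmetric] by (simp add: fl_def v_def mult.assoc)
  have "1 = cmod ((1 + t) - t)" by simp
  also have "\<dots> \<le> cmod (1 + t) + cmod t" by (rule norm_triangle_ineq4)
  finally have t1: "99/100 \<le> cmod (1 + t)" using t(2) \<epsilon> by linarith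
  then have tnz: "1 + t \<noteq> 0" by auto
  define w where "w = (d k 0 4 - t) / (1 + t)"
  have "fl_scale d k g = 1 / (sqrt r * (1 + t)) * (1 + d k 0 4)" unfolding fl_scale_def t3 by (simp add: fl_def)
  also have "\<dots> = rot_scale g * ((1 + d k 0 4) / (1 + t))" by (simp add: rot_scale_def r_def)
  also have "(1 + d k 0 4) / (1 + t) = 1 + w" using tnz by (simp add: w_def field_simps)
  finally have "fl_scale d k g = rot_scale g * (1 + w)" .
  moreover have "cmod w \<le> 8 * \<epsilon>"
  proof -
    have "cmod (d k 0 4 - t) \<le> 6 * \<epsilon>"
      using norm_triangle_ineq4[of "d k 0 4" t] d[of k 0 4] t(2) by simp
    moreover have "8 * \<epsilon> * (99/100) \<le> 8 * \<epsilon> * cmod (1 + t)"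
      using t1 \<epsilon>0 by (intro mult_left_mono) auto
    ultimately have "cmod (d k 0 4 - t) \<le> 8 * \<epsilon> * cmod (1 + t)" using \<epsilon>0 by linarith
    then show ?thesis using tnz by (simp add: w_def norm_divide divide_le_eq)
  qed
  ultimately show ?thesis by blast
qed

text \<open>The sum \<open>u + v\<close> may cancel, hence the error is measured against
  \<open>cmod u + cmod v\<close>. The scale contributes 8 and each of the three other roundings
  2.\<close>

lemma fl_row_error:
  fixes u v ea eb ec :: complex
  assumes d: "\<And>k j i. cmod (d k j i) \<le> \<epsilon>" and \<epsilon>: "\<epsilon> \<le> 1 / 1000"
    and e: "cmod ea \<le> \<epsilon>" "cmod eb \<le> \<epsilon>" "cmod ec \<le> \<epsilon>"
  shows "cmod (fl (fl_scale d k g * fl (u + fl v ea) eb) ec - rot_scale g * (u + v))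
     \<le> 14 * \<epsilon> * rot_scale g * (cmod u + cmod v)"
proof -
  have \<epsilon>0: "0 \<le> \<epsilon>" using d[of 0 0 0] norm_ge_zero order_trans by blast
  obtain w :: complex where w: "fl_scale d k g = rot_scale g * (1 + w)" "cmod w \<le> 8 * \<epsilon>"
    using fl_scale_error[where d = d and \<epsilon> = \<epsilon>, OF d \<epsilon>, of k g] by blast
  have "\<exists>p. (1 + w) * (1 + eb) = 1 + p \<and> cmod p \<le> 10 * \<epsilon>"
    by (rule rel_prod[of w 8 \<epsilon> eb 10]) (use w(2) e \<epsilon> \<epsilon>0 in auto)
  then obtain p where p: "(1 + w) * (1 + eb) = 1 + p" "cmod p \<le> 10 * \<epsilon>" by blast
  have "\<exists>q. (1 + p) * (1 + ec) = 1 + q \<and> cmod q \<le> 12 * \<epsilon>"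
    by (rule rel_prod[of p 10 \<epsilon> ec 12]) (use p(2) e \<epsilon> \<epsilon>0 in auto)
  then obtain q where q: "(1 + p) * (1 + ec) = 1 + q" "cmod q \<le> 12 * \<epsilon>" by blast
  have "\<exists>t. (1 + q) * (1 + ea) = 1 + t \<and> cmod t \<le> 14 * \<epsilon>"
    by (rule rel_prod[of q 12 \<epsilon> ea 14]) (use q(2) e \<epsilon> \<epsilon>0 in auto)
  then obtain t where t: "(1 + q) * (1 + ea) = 1 + t" "cmod t \<le> 14 * \<epsilon>" by blast
  have "fl (fl_scale d k g * fl (u + fl v ea) eb) ec
      = rot_scale g * ((((1 + w) * (1 + eb)) * (1 + ec)) * u + ((((1 + w) * (1 + eb)) * (1 + ec)) * (1 + ea)) * v)"
  proof -
    have "s * W * ((u + v * Z) * X) * Y = s * (((W * X) * Y) * u + (((W * X) * Y) * Z) * v)" for s W X Y Z :: complex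
      by (simp add: algebra_simps)
    then show ?thesis unfolding fl_def w(1) .
  qed
  also have "\<dots> = rot_scale g * (u + v) + rot_scale g * (q * u + t * v)"
    unfolding p q t by (simp add: algebra_simps)
  finally have "cmod (fl (fl_scale d k g * fl (u + fl v ea) eb) ec - rot_scale g * (u + v))
      = rot_scale g * cmod (q * u + t * v)"
    using rot_scale_pos[of g] by (simp add: norm_mult)
  also have "cmod (q * u + t * v) \<le> cmod q * cmod u + cmod t * cmod v"
    by (metis norm_mult norm_triangle_ineq)
  also have "\<dots> \<le> 14 * \<epsilon> * cmod u + 14 * \<epsilon> * cmod v"
    using q(2) t(2) \<epsilon>0 by (intro add_mono mult_right_mono) auto
  finally show ?thesis using rot_scale_pos[of g] by (simp add: algebra_simps)
qed

text \<open>At the pivot nothing cancels: \<open>g\<close> is the rounded quotient, so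
  \<open>b\<close> is \<open>g * a\<close> up to a relative error and \<open>a + cnj g * b\<close>
  is close to (1 + |g|^2) a. The error is therefore relative to \<open>a\<close> alone. The row
  contributes 15 and the division 2, within 20.\<close>

lemma fl_pivot_error:
  fixes a b ea eb ec ed :: complex
  assumes d: "\<And>k j i. cmod (d k j i) \<le> \<epsilon>" and \<epsilon>: "\<epsilon> \<le> 1 / 1000"
    and e: "cmod ea \<le> \<epsilon>" "cmod eb \<le> \<epsilon>" "cmod ec \<le> \<epsilon>" "cmod ed \<le> \<epsilon>"
    and a: "a \<noteq> 0" and g: "g = fl (b / a) ed"
  shows "cmod (rot_scale g * fl (fl_scale d k g * fl (a + fl (cnj g * b) ea) eb) ec - a) \<le> 20 * \<epsilon> * cmod a"
proof -
  have \<epsilon>0: "0 \<le> \<epsilon>" using d[of 0 0 0] norm_ge_zero order_trans by blast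
  define \<sigma> where "\<sigma> = rot_scale g"
  have \<sigma>: "0 < \<sigma>" "\<sigma>\<^sup>2 * (1 + (cmod g)\<^sup>2) = 1"
    using rot_scale_pos[of g] rot_scale_sq[of g] by (auto simp: \<sigma>_def)
  have "1 = cmod ((1 + ed) - ed)" by simp
  also have "\<dots> \<le> cmod (1 + ed) + cmod ed" by (rule norm_triangle_ineq4)
  finally have e31: "99/100 \<le> cmod (1 + ed)" using e \<epsilon> by linarith
  then have nz: "1 + ed \<noteq> 0" by auto
  \<comment> \<open>The division error solved for \<open>b\<close>: \<open>1 + \<psi>\<close> is the
    inverse of \<open>1 + ed\<close>.\<close>
  define \<psi> where "\<psi> = - ed / (1 + ed)"
  have "(2 * \<epsilon>) * (99/100) \<le> (2 * \<epsilon>) * cmod (1 + ed)"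
    using e31 \<epsilon>0 by (intro mult_left_mono) auto
  then have "cmod ed \<le> 2 * \<epsilon> * cmod (1 + ed)" using e(4) \<epsilon>0 by linarith
  then have \<psi>: "cmod \<psi> \<le> 2 * \<epsilon>" using nz by (simp add: \<psi>_def norm_divide divide_le_eq)
  have "1 + \<psi> = 1 / (1 + ed)" using nz by (simp add: \<psi>_def field_simps)
  then have b: "b = g * a * (1 + \<psi>)" using a nz by (simp add: g fl_def)
  define v where "v = cnj g * b"
  have v: "v = complex_of_real ((cmod g)\<^sup>2) * a * (1 + \<psi>)"
    unfolding v_def complex_norm_square by (subst b) (simp add: mult_ac)
  have cv: "cmod v \<le> (cmod g)\<^sup>2 * cmod a * (1 + 1/100)"
  proof -
    have "cmod (1 + \<psi>) \<le> 1 + 1/100" using norm_triangle_ineq[of 1 \<psi>] \<psi> \<epsilon> by simp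
    then show ?thesis unfolding v norm_mult by (intro mult_mono) (auto simp: norm_power)
  qed
  let ?T = "fl (fl_scale d k g * fl (a + fl v ea) eb) ec"
  have "cmod (?T - \<sigma> * (a + v)) \<le> 14 * \<epsilon> * \<sigma> * (cmod a + cmod v)"
    unfolding \<sigma>_def by (rule fl_row_error[where d = d and \<epsilon> = \<epsilon>]) (use d \<epsilon> e in auto)
  then have "\<sigma> * cmod (?T - \<sigma> * (a + v)) \<le> \<sigma> * (14 * \<epsilon> * \<sigma> * (cmod a + cmod v))"
    using \<sigma> by (intro mult_left_mono) auto
  also have "\<dots> = (14 * \<epsilon>) * (\<sigma>\<^sup>2 * (cmod a + cmod v))" by (simp add: power2_eq_square)
  also have "\<dots> \<le> (14 * \<epsilon>) * (\<sigma>\<^sup>2 * ((1 + (cmod g)\<^sup>2) * (cmod a * (1 + 1/100))))"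
  proof (intro mult_left_mono)
    show "cmod a + cmod v \<le> (1 + (cmod g)\<^sup>2) * (cmod a * (1 + 1 / 100))"
      using cv norm_ge_zero[of a] unfolding distrib_right distrib_left mult_1_left mult.assoc by linarith
  qed (use \<epsilon>0 in auto)
  also have "\<dots> = (14 * \<epsilon>) * (1 + 1/100) * cmod a"
    using \<sigma>(2) by (simp add: mult.assoc[symmetric])
  also have "\<dots> \<le> 15 * \<epsilon> * cmod a" using \<epsilon>0 by (intro mult_right_mono) auto
  finally have 1: "cmod (\<sigma> * ?T - \<sigma> * (\<sigma> * (a + v))) \<le> 15 * \<epsilon> * cmod a"
    using \<sigma>(1) by (simp add: right_diff_distrib[symmetric] norm_mult del: right_diff_distrib)
  have sa: "complex_of_real (\<sigma>\<^sup>2) * (1 + complex_of_real ((cmod g)\<^sup>2)) = 1"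
    using arg_cong[OF \<sigma>(2), of complex_of_real] by simp
  have "\<sigma> * (\<sigma> * (a + v)) - a = \<sigma> * (\<sigma> * (a + v)) - (complex_of_real (\<sigma>\<^sup>2) * (1 + complex_of_real ((cmod g)\<^sup>2))) * a"
    unfolding sa by simp
  also have "\<dots> = complex_of_real (\<sigma>\<^sup>2 * (cmod g)\<^sup>2) * a * \<psi>"
    unfolding v by (simp add: power2_eq_square algebra_simps)
  finally have "cmod (\<sigma> * (\<sigma> * (a + v)) - a) = \<sigma>\<^sup>2 * (cmod g)\<^sup>2 * cmod a * cmod \<psi>"
    by (simp add: norm_mult norm_power)
  also have "\<dots> \<le> 1 * cmod a * (2 * \<epsilon>)"
  proof (intro mult_mono)
    show "\<sigma>\<^sup>2 * (cmod g)\<^sup>2 \<le> 1" using \<sigma>(2) zero_le_power2[of \<sigma>] unfolding distrib_left by linarith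
  qed (use \<psi> \<epsilon>0 in auto)
  finally have 2: "cmod (\<sigma> * (\<sigma> * (a + v)) - a) \<le> 2 * \<epsilon> * cmod a" by (simp add: mult_ac)
  have "\<sigma> * ?T - a = (\<sigma> * ?T - \<sigma> * (\<sigma> * (a + v))) + (\<sigma> * (\<sigma> * (a + v)) - a)" by simp
  then have "cmod (\<sigma> * ?T - a) \<le> cmod (\<sigma> * ?T - \<sigma> * (\<sigma> * (a + v))) + cmod (\<sigma> * (\<sigma> * (a + v)) - a)"
    by (metis norm_triangle_ineq)
  also have "\<dots> \<le> 15 * \<epsilon> * cmod a + 2 * \<epsilon> * cmod a" by (rule add_mono[OF 1 2])
  also have "\<dots> \<le> 20 * \<epsilon> * cmod a" using mult_nonneg_nonneg[OF \<epsilon>0 norm_ge_zero[of a]] by linarith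
  finally show ?thesis by (simp add: \<sigma>_def v_def)
qed

section \<open>The floating-point run as an inexact recursion\<close>

fun ls_state :: "perturb \<Rightarrow> complex list \<times> complex list \<Rightarrow> nat \<Rightarrow> complex list \<times> complex list" where
  "ls_state d st 0 = st"
| "ls_state d st (Suc k) = snd (ls_step d k (ls_state d st k))"

lemma ls_run_eq_map:
  "ls_run d k m (ls_state d st k) = map (\<lambda>j. fst (ls_step d j (ls_state d st j))) [k..<k + m]"
proof (induction m arbitrary: k)
  case (Suc m)
  have "ls_run d k (Suc m) (ls_state d st k)
      = fst (ls_step d k (ls_state d st k)) # ls_run d (Suc k) m (ls_state d st (Suc k))"
    by (simp split: prod.split)
  also have "\<dots> = map (\<lambda>j. fst (ls_step d j (ls_state d st j))) (k # [Suc k..<Suc k + m])"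
    unfolding Suc.IH by simp
  also have "k # [Suc k..<Suc k + m] = [k..<k + Suc m]" by (simp add: upt_rec)
  finally show ?case .
qed simp

lemma ls_step_eq:
  "ls_step d k (as, bs) = (let g = fl (bs ! 0 / as ! 0) (d k 0 0) in
    (g, butlast (map (\<lambda>j. fl (fl_scale d k g * fl (as ! j + fl (cnj g * bs ! j) (d k (Suc j) 0)) (d k (Suc j) 1))
          (d k (Suc j) 2)) [0..<length as]),
        tl (map (\<lambda>j. fl (fl_scale d k g * fl (bs ! j - fl (g * as ! j) (d k (Suc j) 3)) (d k (Suc j) 4))
          (d k (Suc j) 5)) [0..<length as])))"
  by (simp add: ls_step_def Let_def fl_scale_def)

text \<open>The level 20 \<epsilon> is set by the pivot estimate, as rows obey 14 \<epsilon>;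
  \<open>small\<close> is \<open>kappa_small\<close> at this level.\<close>

lemma ls_run_layer_run:
  fixes d :: perturb and n :: nat and as bs :: "complex list"
  defines "st \<equiv> ls_state d (as, bs)"
  defines "g \<equiv> \<lambda>k. fst (ls_step d k (st k))"
  defines "A \<equiv> \<lambda>k i. if k \<le> i \<and> i < n then fst (st k) ! (i - k) else 0"
  defines "B \<equiv> \<lambda>k i. if k \<le> i \<and> i < n then snd (st k) ! (i - k) else 0"
  assumes d: "\<And>k j i. cmod (d k j i) \<le> \<epsilon>" and \<epsilon>: "\<epsilon> \<le> 1 / 1000" and small: "120 * real n * \<epsilon> \<le> 1"
    and len: "length as = n" "length bs = n" and n: "0 < n" and a0: "as ! 0 \<noteq> 0"
    and start: "(vnorm n (A 0))\<^sup>2 + (vnorm n (B 0))\<^sup>2 \<le> 1"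
  shows "\<exists>L. layer_run n (20 * \<epsilon>) g A B L"
proof -
  have \<epsilon>0: "0 \<le> \<epsilon>" using d[of 0 0 0] norm_ge_zero order_trans by blast
  define top where "top = (\<lambda>k j. fl (fl_scale d k (g k) * fl (fst (st k) ! j + fl (cnj (g k) * snd (st k) ! j)
     (d k (Suc j) 0)) (d k (Suc j) 1)) (d k (Suc j) 2))"
  define bot where "bot = (\<lambda>k j. fl (fl_scale d k (g k) * fl (snd (st k) ! j - fl (g k * fst (st k) ! j)
     (d k (Suc j) 3)) (d k (Suc j) 4)) (d k (Suc j) 5))"
  have gk: "g k = fl (snd (st k) ! 0 / fst (st k) ! 0) (d k 0 0)" for k
    unfolding g_def by (cases "st k") (simp add: ls_step_eq Let_def)
  have st_Suc: "st (Suc k) = (butlast (map (top k) [0..<length (fst (st k))]), tl (map (bot k) [0..<length (fst (st k))]))" for k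
  proof -
    obtain x y where xy: "st k = (x, y)" by fastforce
    have "st (Suc k) = snd (ls_step d k (st k))" by (simp add: st_def)
    then show ?thesis unfolding top_def bot_def gk xy by (simp add: ls_step_eq Let_def)
  qed
  have lens: "length (fst (st k)) = n - k" for k
  proof (induction k)
    case 0
    then show ?case using len by (simp add: st_def)
  next
    case (Suc k)
    then show ?case by (simp add: st_Suc)
  qed
  define L where "L = (\<lambda>k i. if k \<le> i \<and> i < n then top k (i - k) else 0)"
  have A_Suc: "A (Suc k) i = shift_down (Suc 0) (L k) i" if "i < n" for k i
    using that by (auto simp: A_def L_def shift_down_def st_Suc lens nth_butlast Suc_le_eq)
  have B_Suc: "B (Suc k) i = (if k < i then bot k (i - k) else 0)" if "i < n" for k i
    using that by (auto simp: B_def st_Suc lens nth_tl Suc_diff_Suc Suc_le_eq)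
  have diag: "cmod (rot_scale (g k) * L k k - A k k) \<le> 20 * \<epsilon> * cmod (A k k)" if "k < n" "A k k \<noteq> 0" for k
  proof -
    have "A k k = fst (st k) ! 0" "L k k = top k 0" using that by (auto simp: A_def L_def)
    then show ?thesis unfolding top_def
      using fl_pivot_error[where d = d and \<epsilon> = \<epsilon> and ea = "d k (Suc 0) 0" and eb = "d k (Suc 0) 1"
          and ec = "d k (Suc 0) 2", OF d \<epsilon> d d d d _ gk, of k k] that(2) by simp
  qed
  \<comment> \<open>A relative error of at most 20 \<epsilon> < 1 cannot annihilate a nonzero pivot,
    and the shift passes it on unchanged.\<close>
  have pivot: "k < n \<Longrightarrow> A k k \<noteq> 0" for k
  proof (induction k)
    case 0
    then show ?case using a0 by (simp add: A_def st_def)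
  next
    case (Suc k)
    have "L k k \<noteq> 0"
    proof
      assume "L k k = 0"
      then have "1 * cmod (A k k) \<le> (20 * \<epsilon>) * cmod (A k k)" using diag[of k] Suc by simp
      then have "1 \<le> 20 * \<epsilon>" using Suc by (simp only: mult_le_cancel_right) simp
      then show False using \<epsilon> by linarith
    qed
    then show ?case using A_Suc[of "Suc k" k] Suc by (simp add: shift_down_def)
  qed
  have row: "14 * \<epsilon> * rot_scale x * (p + q) \<le> 20 * \<epsilon> * rot_scale x * (p + q)" if "0 \<le> p" "0 \<le> q" for x p q
    using \<epsilon>0 rot_scale_pos[of x] that by (intro mult_right_mono) auto
  have "layer_run n (20 * \<epsilon>) g A B L"
  proof
    fix k i assume k: "k < n" and i: "i < n"
    show "cmod (L k i - rot_scale (g k) * (A k i + cnj (g k) * B k i))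
        \<le> 20 * \<epsilon> * rot_scale (g k) * (cmod (A k i) + cmod (g k) * cmod (B k i))"
    proof (cases "k \<le> i")
      case True
      then have eq: "L k i = top k (i - k)" "A k i = fst (st k) ! (i - k)" "B k i = snd (st k) ! (i - k)"
        using i by (auto simp: L_def A_def B_def)
      have "cmod (L k i - rot_scale (g k) * (A k i + cnj (g k) * B k i))
          \<le> 14 * \<epsilon> * rot_scale (g k) * (cmod (A k i) + cmod (cnj (g k) * B k i))"
        unfolding eq top_def by (rule fl_row_error[where d = d and \<epsilon> = \<epsilon>, OF d \<epsilon> d d d])
      then show ?thesis using row[of "cmod (A k i)" "cmod (g k) * cmod (B k i)" "g k"]
        by (simp add: norm_mult)
    qed (simp add: L_def A_def B_def)
    show "cmod (B (Suc k) i - rot_scale (g k) * (B k i - g k * A k i))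
        \<le> 20 * \<epsilon> * rot_scale (g k) * (cmod (B k i) + cmod (g k) * cmod (A k i))"
    proof (cases i k rule: linorder_cases)
      case greater
      then have eq: "B (Suc k) i = bot k (i - k)" "A k i = fst (st k) ! (i - k)" "B k i = snd (st k) ! (i - k)"
        using i by (auto simp: B_Suc) (auto simp: A_def B_def)
      \<comment> \<open>\<open>fl\<close> commutes with negation, so the subtraction is an instance
        of the additive \<open>fl_row_error\<close>.\<close>
      have "cmod (fl (fl_scale d k (g k) * fl (B k i + fl (- (g k * A k i)) (d k (Suc (i - k)) 3)) (d k (Suc (i - k)) 4))
           (d k (Suc (i - k)) 5) - rot_scale (g k) * (B k i + - (g k * A k i)))
          \<le> 14 * \<epsilon> * rot_scale (g k) * (cmod (B k i) + cmod (- (g k * A k i)))"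
        by (rule fl_row_error[where d = d and \<epsilon> = \<epsilon>, OF d \<epsilon> d d d])
      then have "cmod (B (Suc k) i - rot_scale (g k) * (B k i - g k * A k i))
          \<le> 14 * \<epsilon> * rot_scale (g k) * (cmod (B k i) + cmod (g k) * cmod (A k i))"
        unfolding eq bot_def by (simp add: fl_def norm_mult)
      then show ?thesis using row[of "cmod (B k i)" "cmod (g k) * cmod (A k i)" "g k"] by simp
    next
      case equal
      \<comment> \<open>The algorithm discards this entry, which amounts to setting it to 0. An
        exact rotation with the computed \<open>g k\<close> would leave there only the rounding
        error of the division.\<close>
      have "g k = B k k / A k k * (1 + d k 0 0)" using k by (simp add: gk fl_def A_def B_def)
      then have "B k k - g k * A k k = - B k k * d k 0 0" using pivot[OF k] by (simp add: field_simps)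
      then have "cmod (B (Suc k) i - rot_scale (g k) * (B k i - g k * A k i)) = cmod (d k 0 0) * rot_scale (g k) * cmod (B k i)"
        using equal k rot_scale_pos[of "g k"] by (simp add: B_Suc norm_mult)
      also have "\<dots> \<le> 20 * \<epsilon> * rot_scale (g k) * cmod (B k i)"
        using d[of k 0 0] \<epsilon>0 rot_scale_pos[of "g k"] by (intro mult_right_mono) auto
      also have "\<dots> \<le> 20 * \<epsilon> * rot_scale (g k) * (cmod (B k i) + cmod (g k) * cmod (A k i))"
        using \<epsilon>0 rot_scale_pos[of "g k"] by (intro mult_left_mono) auto
      finally show ?thesis .
    next
      case less
      then show ?thesis using i by (simp add: B_Suc) (simp add: A_def B_def)
    qed
    show "A (Suc k) i = shift_down (Suc 0) (L k) i" using A_Suc i by simp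
  next
    show "cmod (rot_scale (g k) * L k k - A k k) \<le> 20 * \<epsilon> * cmod (A k k)" if "k < n" for k
      using diag pivot that by blast
    show "A 0 0 \<noteq> 0" using pivot n by blast
    show "L k i = 0" if "i < k" for k i using that by (simp add: L_def)
    show "B n i = 0" if "i < n" for i using that by (simp add: B_def)
  qed (use \<epsilon>0 small start in auto)
  then show ?thesis by blast
qed

section \<open>Laurent polynomials on the unit circle\<close>

lemma leval_superset:
  assumes "finite S" "{k. p k \<noteq> 0} \<subseteq> S"
  shows "leval p z = (\<Sum>k\<in>S. p k * z powi k)"
  unfolding leval_def using assms by (intro sum.mono_neutral_left) auto

lemma leval_eq_peval:
  assumes "\<And>k. k < 0 \<or> int n \<le> k \<Longrightarrow> p k = 0"
  shows "leval p z = peval n (\<lambda>i. p (int i)) z"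
proof -
  have "k \<in> int ` {..<n}" if "p k \<noteq> 0" for k
  proof -
    have "0 \<le> k \<and> k < int n" using assms[of k] that by (meson not_le)
    then show ?thesis by (intro image_eqI[of _ _ "nat k"]) auto
  qed
  then have "leval p z = (\<Sum>k\<in>int ` {..<n}. p k * z powi k)"
    by (intro leval_superset) auto
  then show ?thesis by (simp add: peval_def sum.reindex)
qed

lemma leval_ladd:
  assumes "is_lpoly p" "is_lpoly q"
  shows "leval (ladd p q) z = leval p z + leval q z"
proof -
  let ?S = "{k. p k \<noteq> 0} \<union> {k. q k \<noteq> 0}"
  have f: "finite ?S" using assms by (simp add: is_lpoly_def)
  have "leval (ladd p q) z = (\<Sum>k\<in>?S. ladd p q k * z powi k)" "leval p z = (\<Sum>k\<in>?S. p k * z powi k)"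
    "leval q z = (\<Sum>k\<in>?S. q k * z powi k)"
    by (intro leval_superset[OF f]; auto simp: ladd_def)+
  then show ?thesis by (simp add: ladd_def sum.distrib distrib_right)
qed

lemma lmult_support: "{k. lmult p q k \<noteq> 0} \<subseteq> (\<lambda>(i, j). i + j) ` ({k. p k \<noteq> 0} \<times> {k. q k \<noteq> 0})"
proof
  fix k assume "k \<in> {k. lmult p q k \<noteq> 0}"
  then obtain j where "p j \<noteq> 0" "p j * q (k - j) \<noteq> 0"
    unfolding lmult_def by (auto elim: sum.not_neutral_contains_not_neutral)
  then show "k \<in> (\<lambda>(i, j). i + j) ` ({k. p k \<noteq> 0} \<times> {k. q k \<noteq> 0})"
    by (intro image_eqI[of _ _ "(j, k - j)"]) auto
qed

lemma is_lpoly_lmult: "is_lpoly p \<Longrightarrow> is_lpoly q \<Longrightarrow> is_lpoly (lmult p q)"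
  unfolding is_lpoly_def by (rule finite_subset[OF lmult_support]) auto

lemma leval_lmult:
  assumes p: "is_lpoly p" and q: "is_lpoly q" and z: "z \<noteq> 0"
  shows "leval (lmult p q) z = leval p z * leval q z"
proof -
  let ?S = "{k. p k \<noteq> 0}" and ?T = "{k. q k \<noteq> 0}"
  define U where "U = (\<lambda>(i, j). i + j) ` (?S \<times> ?T)"
  have fin: "finite ?S" "finite ?T" "finite U" using p q by (auto simp: is_lpoly_def U_def)
  \<comment> \<open>The sumset \<open>U\<close> of the supports, shifted by any such
    \<open>j\<close>, still covers the support of \<open>q\<close>.\<close>
  have inner: "(\<Sum>k\<in>U. q (k - j) * z powi (k - j)) = leval q z" if j: "p j \<noteq> 0" for j
  proof -
    have "?T \<subseteq> (\<lambda>k. k - j) ` U"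
    proof
      fix i assume "i \<in> ?T"
      then have "j + i \<in> U" using j by (auto simp: U_def)
      then show "i \<in> (\<lambda>k. k - j) ` U" by (intro image_eqI[of _ _ "j + i"]) auto
    qed
    then have "leval q z = (\<Sum>i\<in>(\<lambda>k. k - j) ` U. q i * z powi i)"
      using fin by (intro leval_superset) auto
    also have "\<dots> = (\<Sum>k\<in>U. q (k - j) * z powi (k - j))"
      by (subst sum.reindex) (auto simp: inj_on_def)
    finally show ?thesis by simp
  qed
  have "leval (lmult p q) z = (\<Sum>k\<in>U. lmult p q k * z powi k)"
    using lmult_support[of p q] fin by (intro leval_superset) (auto simp: U_def)
  also have "\<dots> = (\<Sum>k\<in>U. \<Sum>j\<in>?S. (p j * z powi j) * (q (k - j) * z powi (k - j)))"
    unfolding lmult_def sum_distrib_right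
  proof (intro sum.cong refl)
    fix k j
    have "z powi k = z powi j * z powi (k - j)" using z by (simp add: power_int_add[symmetric])
    then show "p j * q (k - j) * z powi k = (p j * z powi j) * (q (k - j) * z powi (k - j))" by simp
  qed
  also have "\<dots> = (\<Sum>j\<in>?S. \<Sum>k\<in>U. (p j * z powi j) * (q (k - j) * z powi (k - j)))"
    by (rule sum.swap)
  also have "\<dots> = (\<Sum>j\<in>?S. (p j * z powi j) * leval q z)"
    by (intro sum.cong refl) (simp add: sum_distrib_left[symmetric] inner)
  also have "\<dots> = leval p z * leval q z" by (simp add: leval_def sum_distrib_right)
  finally show ?thesis .
qed

lemma is_lpoly_lstar: "is_lpoly p \<Longrightarrow> is_lpoly (lstar p)"
proof -
  assume p: "is_lpoly p"
  have "{k. lstar p k \<noteq> 0} = uminus ` {k. p k \<noteq> 0}"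
    by (auto simp: lstar_def intro!: image_eqI[of _ _ "- x" for x])
  then show ?thesis using p by (simp add: is_lpoly_def)
qed

lemma lstar_lstar [simp]: "lstar (lstar p) = p"
  by (simp add: lstar_def)

lemma leval_lstar:
  assumes z: "cmod z = 1"
  shows "leval (lstar p) z = cnj (leval p z)"
proof -
  have zz: "cnj z = inverse z"
    using z by (metis complex_norm_square inverse_unique of_real_1 power_one)
  have "leval (lstar p) z = (\<Sum>k\<in>{k. p k \<noteq> 0}. cnj (p k) * z powi (- k))"
    unfolding leval_def
    by (rule sum.reindex_bij_witness[of _ uminus uminus]) (auto simp: lstar_def)
  also have "\<dots> = cnj (leval p z)"
    unfolding leval_def cnj_sum
    by (intro sum.cong) (auto simp: power_int_minus power_int_inverse zz)
  finally show ?thesis .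
qed

lemma leval_lconst_1: "leval (lconst 1) z = 1"
  by (subst leval_superset[of "{0}"]) (auto simp: lconst_def)

lemma S_set_circle:
  assumes ab: "(a, b) \<in> S_set" and z: "cmod z = 1"
  shows "(cmod (leval (lstar a) z))\<^sup>2 + (cmod (leval b z))\<^sup>2 = 1"
proof -
  have l: "is_lpoly a" "is_lpoly b" "ladd (lmult a (lstar a)) (lmult b (lstar b)) = lconst 1"
    using ab by (auto simp: S_set_def)
  have z0: "z \<noteq> 0" using z by auto
  have "leval a z * cnj (leval a z) + leval b z * cnj (leval b z) = 1"
    using arg_cong[OF l(3), of "\<lambda>p. leval p z"] l(1,2) z0
    by (simp add: leval_ladd is_lpoly_lmult is_lpoly_lstar leval_lmult leval_lstar[OF z] leval_lconst_1)
  then have "complex_of_real ((cmod (leval a z))\<^sup>2 + (cmod (leval b z))\<^sup>2) = complex_of_real 1"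
    unfolding of_real_add complex_norm_square by simp
  then have "(cmod (leval a z))\<^sup>2 + (cmod (leval b z))\<^sup>2 = 1"
    by (simp only: of_real_eq_iff)
  then show ?thesis by (simp add: leval_lstar[OF z])
qed

text \<open>\<open>Sup\<close> bounds its set only once the set is known to be bounded; the sum of
  the coefficient moduli does this.\<close>

lemma S_eta_circle_bound:
  assumes ab: "(a, b) \<in> S_eta \<eta>" and z: "cmod z = 1"
  shows "cmod (leval b z) \<le> 1 - \<eta>"
proof -
  have "cmod (leval b w) \<le> (\<Sum>k\<in>{k. b k \<noteq> 0}. cmod (b k))" if "w \<in> sphere 0 1" for w
    unfolding leval_def using that
    by (intro sum_norm_le) (simp add: norm_mult norm_power_int)
  then have "bdd_above ((\<lambda>z. cmod (leval b z)) ` sphere 0 1)"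
    unfolding bdd_above_def by blast
  then have "cmod (leval b z) \<le> Sup ((\<lambda>z. cmod (leval b z)) ` sphere 0 1)"
    using z by (intro cSUP_upper) auto
  then show ?thesis using ab by (simp add: S_eta_def)
qed

text \<open>On the circle |a|^2 = 1 - |b|^2 \<ge> 1 - (1 - \<eta>)^2 = \<eta> + \<eta> (1 -
  \<eta>).\<close>

lemma S_eta_outer_circle:
  assumes ab: "(a, b) \<in> S_eta \<eta>" and \<eta>: "0 < \<eta>" "\<eta> < 1" and z: "cmod z = 1"
  shows "\<eta> \<le> (cmod (leval (lstar a) z))\<^sup>2"
proof -
  have "(cmod (leval b z))\<^sup>2 \<le> (1 - \<eta>)\<^sup>2"
    using S_eta_circle_bound[OF ab z] by (intro power_mono) auto
  also have "\<dots> = 1 - \<eta> - \<eta> * (1 - \<eta>)" by (simp add: power2_eq_square algebra_simps)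
  also have "\<dots> \<le> 1 - \<eta>" using \<eta> by simp
  finally show ?thesis using S_set_circle[OF _ z, of a b] ab by (simp add: S_eta_def)
qed

lemma lmult_lstar_0: "lmult p (lstar p) 0 = complex_of_real (\<Sum>k\<in>{k. p k \<noteq> 0}. (cmod (p k))\<^sup>2)"
  by (simp add: lmult_def lstar_def complex_norm_square del: of_real_power)

lemma sum_reindexed_le_support:
  fixes n :: nat
  assumes "is_lpoly p" "inj_on h {..<n}"
  shows "(\<Sum>i<n. (cmod (p (h i)))\<^sup>2) \<le> (\<Sum>k\<in>{k. p k \<noteq> 0}. (cmod (p k))\<^sup>2)"
proof -
  have "(\<Sum>i<n. (cmod (p (h i)))\<^sup>2) = (\<Sum>k\<in>h ` {..<n}. (cmod (p k))\<^sup>2)"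
    using assms(2) by (simp add: sum.reindex)
  also have "\<dots> = (\<Sum>k\<in>h ` {..<n} \<inter> {k. p k \<noteq> 0}. (cmod (p k))\<^sup>2)"
    by (rule sum.mono_neutral_right) auto
  also have "\<dots> \<le> (\<Sum>k\<in>{k. p k \<noteq> 0}. (cmod (p k))\<^sup>2)"
    using assms(1) by (intro sum_mono2) (auto simp: is_lpoly_def)
  finally show ?thesis .
qed

text \<open>Compares the constant coefficients in a a* + b b* = 1, which are squared l2 norms by
  \<open>lmult_lstar_0\<close>.\<close>

lemma S_set_coeff_norm:
  assumes ab: "(a, b) \<in> S_set"
  shows "(vnorm n (\<lambda>i. lstar a (int i)))\<^sup>2 + (vnorm n (\<lambda>i. b (int i)))\<^sup>2 \<le> 1"
proof -
  have l: "is_lpoly a" "is_lpoly b" "ladd (lmult a (lstar a)) (lmult b (lstar b)) = lconst 1"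
    using ab by (auto simp: S_set_def)
  have "complex_of_real ((\<Sum>k\<in>{k. a k \<noteq> 0}. (cmod (a k))\<^sup>2) + (\<Sum>k\<in>{k. b k \<noteq> 0}. (cmod (b k))\<^sup>2)) = complex_of_real 1"
    using fun_cong[OF l(3), of 0] unfolding ladd_def lmult_lstar_0 by (simp add: lconst_def)
  then have "(\<Sum>k\<in>{k. a k \<noteq> 0}. (cmod (a k))\<^sup>2) + (\<Sum>k\<in>{k. b k \<noteq> 0}. (cmod (b k))\<^sup>2) = 1"
    by (simp only: of_real_eq_iff)
  moreover have "(vnorm n (\<lambda>i. lstar a (int i)))\<^sup>2 \<le> (\<Sum>k\<in>{k. a k \<noteq> 0}. (cmod (a k))\<^sup>2)"
    using sum_reindexed_le_support[OF l(1), of "\<lambda>i. - int i" n]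
    by (simp add: vnorm_sq lstar_def inj_on_def)
  moreover have "(vnorm n (\<lambda>i. b (int i)))\<^sup>2 \<le> (\<Sum>k\<in>{k. b k \<noteq> 0}. (cmod (b k))\<^sup>2)"
    using sum_reindexed_le_support[OF l(2), of int n] by (simp add: vnorm_sq)
  ultimately show ?thesis by linarith
qed

section \<open>The relative error of layer stripping\<close>

lemma l2norm_eq_vnorm:
  assumes "\<And>k. k < 0 \<or> int n \<le> k \<Longrightarrow> f k = 0"
  shows "l2norm f = vnorm n (\<lambda>i. f (int i))"
proof -
  have "k \<in> int ` {..<n}" if "f k \<noteq> 0" for k
  proof -
    have "0 \<le> k \<and> k < int n" using assms[of k] that by (meson not_le)
    then show ?thesis by (intro image_eqI[of _ _ "nat k"]) auto
  qed
  then have "(\<Sum>k\<in>{k. f k \<noteq> 0}. (cmod (f k))\<^sup>2) = (\<Sum>k\<in>int ` {..<n}. (cmod (f k))\<^sup>2)"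
    by (intro sum.mono_neutral_left) auto
  then show ?thesis by (simp add: l2norm_def vnorm_def L2_set_def sum.reindex)
qed

lemma sum_le_sqrt_vnorm: "(\<Sum>j<n. cmod (x j)) \<le> sqrt (real n) * vnorm n x"
  using L2_set_mult_ineq[of "\<lambda>_. 1" "\<lambda>j. cmod (x j)" "{..<n}"]
  by (simp add: vnorm_def L2_set_def)

lemma vnorm_le_sqrt_bound:
  assumes "\<And>i. i < n \<Longrightarrow> cmod (x i) \<le> M" "0 \<le> M"
  shows "vnorm n x \<le> sqrt (real n) * M"
proof (rule power2_le_imp_le)
  have "(vnorm n x)\<^sup>2 \<le> (\<Sum>i<n. M\<^sup>2)"
    unfolding vnorm_sq using assms by (intro sum_mono power_mono) auto
  then show "(vnorm n x)\<^sup>2 \<le> (sqrt (real n) * M)\<^sup>2" by (simp add: power_mult_distrib)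
qed (use assms in simp)

text \<open>Inserting the second hypothesis gives x \<le> D (2 h + x), and
  \<open>D \<le> 1 / 2\<close> moves the last term to the left. For \<open>h = 0\<close> the
  quotient is 0 by convention.\<close>

lemma relative_error_absorb:
  fixes x g h D :: real
  assumes "x \<le> D * (h + g)" "g \<le> x + h" "0 \<le> D" "D \<le> 1 / 2" "0 \<le> h"
  shows "x / h \<le> 4 * D"
proof (cases "h = 0")
  case False
  have "D * (h + g) \<le> D * (2 * h) + D * x" using assms mult_left_mono[of g "x + h" D] by (simp add: algebra_simps)
  moreover have "D * x \<le> 1/2 * x" if "0 \<le> x" using that assms by (intro mult_right_mono) auto
  moreover have "0 \<le> D * h" using assms by simp
  ultimately have "x \<le> 4 * D * h" using assms by (cases "0 \<le> x") linarith+
  then show ?thesis using False assms by (simp add: divide_le_eq)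
qed (use assms in simp)

text \<open>The bound on single coefficients has the constant 400 * 20 = 8000. One sqrt n turns it
  into an l2 bound, another turns the l1 sums on the right into l2 norms. Absorption requires 8000
  times the small quantity to be at most 1/2, hence 1/16000, and multiplies by 4, hence
  32000.\<close>

lemma layer_strip_fl_error:
  fixes n :: nat and \<eta> \<epsilon> :: real and a b :: lpoly and \<gamma> :: "int \<Rightarrow> complex" and d :: perturb
  assumes n: "n \<ge> 1" and \<eta>: "0 < \<eta>" "\<eta> < 1" and ab: "(a, b) \<in> S_eta \<eta>"
    and deg: "\<And>k. int n \<le> k \<Longrightarrow> b k = 0" and out: "outer_poly (lstar a)"
    and fin: "finite {k. \<gamma> k \<noteq> 0}" and nlft: "nlft \<gamma> = (a, b)"
    and \<epsilon>: "0 < \<epsilon>" and d: "\<And>k j i. cmod (d k j i) \<le> \<epsilon>"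
    and small: "real n ^ 3 * \<eta> powr (-5/2) * \<epsilon> \<le> 1 / 16000"
  shows "l2norm (\<lambda>k. ext_seq (layer_strip_fl d n a b) k - \<gamma> k) / l2norm \<gamma>
      \<le> 32000 * real n ^ 3 * \<eta> powr (-5/2) * \<epsilon>"
proof -
  define \<delta> where "\<delta> = real n ^ 3 * \<eta> powr (-5/2) * \<epsilon>"
  have \<eta>pow: "1 / \<eta>\<^sup>2 \<le> \<eta> powr (-5/2)"
  proof -
    have "1 / \<eta>\<^sup>2 = \<eta> powr (-2)" using \<eta> by (simp add: powr_minus_divide)
    also have "\<dots> \<le> \<eta> powr (-5/2)" using \<eta> by (intro powr_mono') auto
    finally show ?thesis .
  qed
  have n3\<epsilon>: "real n ^ 3 * \<epsilon> / \<eta>\<^sup>2 \<le> \<delta>"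
    using mult_left_mono[OF \<eta>pow, of "real n ^ 3 * \<epsilon>"] \<epsilon> by (simp add: \<delta>_def mult_ac)
  have \<eta>2: "\<eta>\<^sup>2 \<le> \<eta>" "0 < \<eta>\<^sup>2" using \<eta> by (auto simp: power2_eq_square mult_left_le)
  have n3: "real n ^ 3 * \<epsilon> \<le> \<eta> / 16000"
  proof -
    have "real n ^ 3 * \<epsilon> \<le> \<delta> * \<eta>\<^sup>2" using n3\<epsilon> \<eta>2 by (simp add: divide_le_eq)
    also have "\<dots> \<le> 1 / 16000 * \<eta>" using small \<eta>2 \<eta> unfolding \<delta>_def by (intro mult_mono) auto
    finally show ?thesis by simp
  qed
  have pw: "real n \<le> real n ^ 3" "(real n)\<^sup>2 \<le> real n ^ 3" "1 \<le> real n ^ 3"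
    using n power_increasing[of 1 3 "real n"] power_increasing[of 2 3 "real n"] power_increasing[of 0 3 "real n"] by auto
  have small': "\<epsilon> \<le> 1 / 1000" "120 * real n * \<epsilon> \<le> 1" "36 * (real n)\<^sup>2 * (20 * \<epsilon>) \<le> \<eta>"
    using n3 \<eta> pw[THEN mult_right_mono[OF _ less_imp_le[OF \<epsilon>]]] by linarith+
  have S: "(a, b) \<in> S_set" and bpoly: "\<And>k. k < 0 \<Longrightarrow> b k = 0" and apoly: "\<And>k. k < 0 \<Longrightarrow> lstar a k = 0"
    using ab by (auto simp: S_eta_def is_poly_def S_set_def)
  have supp: "{k. \<gamma> k \<noteq> 0} \<subseteq> {0..int n - 1}"
    using deg by (intro nlft_support[OF fin nlft bpoly]) auto
  define c where "c = (\<lambda>k. nlft_col \<gamma> [int k..int n - 1])"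
  have cab: "fst (c 0) = b" "snd (c 0) = lstar a"
    using nlft nlft_eq_col[OF supp] by (auto simp: c_def)
  \<comment> \<open>The degree of a* is inherited from the product of n factors indexed by 0, ..., n
    - 1.\<close>
  have adeg: "lstar a k = 0" if "int n \<le> k" for k
    using nlft_col_snd_support[of k "int n - 1" 0 \<gamma>] cab(2) that n by (simp add: c_def)
  define as where "as = map (\<lambda>j. lstar a (int j)) [0..<n]"
  define bs where "bs = map (\<lambda>j. b (int j)) [0..<n]"
  define st where "st = ls_state d (as, bs)"
  define g where "g = (\<lambda>k. fst (ls_step d k (st k)))"
  define A where "A = (\<lambda>k i. if k \<le> i \<and> i < n then fst (st k) ! (i - k) else 0)"
  define B where "B = (\<lambda>k i. if k \<le> i \<and> i < n then snd (st k) ! (i - k) else 0)"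
  have A0: "A 0 = (\<lambda>i. lstar a (int i))" using adeg by (auto simp: A_def st_def as_def fun_eq_iff)
  have B0: "B 0 = (\<lambda>i. b (int i))" using deg by (auto simp: B_def st_def bs_def fun_eq_iff)
  have as0: "as ! 0 \<noteq> 0" using S n by (auto simp: as_def S_set_def)
  have start: "(vnorm n (A 0))\<^sup>2 + (vnorm n (B 0))\<^sup>2 \<le> 1"
    unfolding A0 B0 by (rule S_set_coeff_norm[OF S])
  have "\<exists>L. layer_run n (20 * \<epsilon>) g A B L"
    unfolding g_def A_def B_def st_def
  proof (rule ls_run_layer_run)
    show "(vnorm n (\<lambda>i. if 0 \<le> i \<and> i < n then fst (ls_state d (as, bs) 0) ! (i - 0) else 0))\<^sup>2 +
      (vnorm n (\<lambda>i. if 0 \<le> i \<and> i < n then snd (ls_state d (as, bs) 0) ! (i - 0) else 0))\<^sup>2 \<le> 1"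
      using start unfolding A_def B_def st_def .
  qed (use d small' as0 n in \<open>auto simp: as_def bs_def\<close>)
  then obtain L where run: "layer_run n (20 * \<epsilon>) g A B L" by blast
  have exact: "layer_run n 0 (\<lambda>k. \<gamma> (int k)) (\<lambda>k i. snd (c k) (int i - int k)) (\<lambda>k i. fst (c k) (int i))
      (\<lambda>k i. snd (c (Suc k)) (int i - int k))"
    unfolding c_def by (rule nlft_exact_run) (use S_set_coeff_norm[OF S, of n] cab in \<open>simp add: c_def\<close>)
  have peval_a: "peval n (A 0) z = leval (lstar a) z" for z
    unfolding A0 using apoly adeg by (intro leval_eq_peval[symmetric]) auto
  have nz: "peval n (A 0) z \<noteq> 0" if "cmod z < 1" for z
    using out that by (simp add: peval_a outer_poly_def)
  have circ: "\<eta> \<le> (cmod (peval n (A 0) z))\<^sup>2" if "cmod z = 1" for z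
    unfolding peval_a by (rule S_eta_outer_circle[OF ab \<eta> that])
  define h where "h = (\<lambda>k. \<gamma> (int k))"
  define H where "H = (\<Sum>j<n. cmod (h j))"
  define G where "G = (\<Sum>j<n. cmod (g j))"
  define M where "M = 400 * (real n)\<^sup>2 * (20 * \<epsilon>) / \<eta>\<^sup>2"
  have M0: "0 \<le> M" using \<epsilon> by (simp add: M_def)
  have ptw: "cmod (g k - h k) \<le> M * (H + G)" if "k < n" for k
    unfolding M_def H_def G_def h_def
  proof (rule layer_run_compare[OF run exact])
    show "(\<lambda>i. snd (c 0) (int i - int 0)) = A 0" "(\<lambda>i. fst (c 0) (int i)) = B 0" by (simp_all add: A0 B0 cab)
    show "\<eta> * (vnorm n x)\<^sup>2 \<le> cmod (gram_form n (A 0) (B 0) x x)" for x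
      by (rule gram_form_coercive[OF nz \<eta>(1) circ])
    show "sqrt \<eta> \<le> cmod (A 0 0)"
      using n by (intro constant_term_lower_bound[OF nz \<eta>(1) circ]) auto
  qed (use \<eta> small' that in auto)
  define x where "x = vnorm n (\<lambda>k. g k - h k)"
  have GH: "0 \<le> G" "0 \<le> H" by (auto simp: G_def H_def intro: sum_nonneg)
  have "x \<le> sqrt (real n) * (M * (H + G))"
    unfolding x_def using ptw M0 GH by (intro vnorm_le_sqrt_bound) auto
  also have "\<dots> \<le> sqrt (real n) * (M * (sqrt (real n) * vnorm n h + sqrt (real n) * vnorm n g))"
    unfolding H_def G_def using M0 by (intro mult_left_mono add_mono sum_le_sqrt_vnorm) auto
  also have "\<dots> = (sqrt (real n) * sqrt (real n)) * M * (vnorm n h + vnorm n g)"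
    by (simp only: distrib_left mult_ac)
  also have "\<dots> = real n * M * (vnorm n h + vnorm n g)" by simp
  finally have xle: "x \<le> real n * M * (vnorm n h + vnorm n g)" .
  have nM: "real n * M = 8000 * (real n ^ 3 * \<epsilon> / \<eta>\<^sup>2)"
    by (simp add: M_def power2_eq_square power3_eq_cube)
  have "vnorm n g = vnorm n (\<lambda>k. (g k - h k) + h k)" by simp
  also have "\<dots> \<le> x + vnorm n h" unfolding x_def by (rule vnorm_add)
  finally have gle: "vnorm n g \<le> x + vnorm n h" .
  have "real n * M \<le> 1 / 2" using nM n3\<epsilon> small unfolding \<delta>_def by linarith
  then have "x / vnorm n h \<le> 4 * (real n * M)"
    using xle gle M0 by (intro relative_error_absorb) auto
  also have "\<dots> \<le> 32000 * \<delta>" using nM n3\<epsilon> by simp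
  finally have main: "x / vnorm n h \<le> 32000 * \<delta>" .
  have out_eq: "layer_strip_fl d n a b = map g [0..<n]"
    using ls_run_eq_map[of d 0 n "(as, bs)"] by (simp add: layer_strip_fl_def g_def st_def as_def bs_def)
  have \<gamma>0: "\<gamma> k = 0" if "k < 0 \<or> int n \<le> k" for k using supp that by force
  have "l2norm \<gamma> = vnorm n h" unfolding h_def using \<gamma>0 by (rule l2norm_eq_vnorm)
  moreover have "l2norm (\<lambda>k. ext_seq (layer_strip_fl d n a b) k - \<gamma> k) = x"
  proof -
    have "l2norm (\<lambda>k. ext_seq (layer_strip_fl d n a b) k - \<gamma> k)
        = vnorm n (\<lambda>i. ext_seq (layer_strip_fl d n a b) (int i) - \<gamma> (int i))"
      using \<gamma>0 by (intro l2norm_eq_vnorm) (auto simp: ext_seq_def out_eq)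
    also have "\<dots> = x" unfolding x_def by (rule vnorm_cong) (simp add: ext_seq_def out_eq h_def)
    finally show ?thesis .
  qed
  ultimately show ?thesis using main by (simp add: \<delta>_def mult_ac)
qed

theorem theorem5p5:
  "\<exists>c C :: real. c > 0 \<and> C > 0 \<and>
    (\<forall>(n::nat) (\<eta>::real) (a::lpoly) (b::lpoly) (\<gamma>::int \<Rightarrow> complex) (\<epsilon>::real) (d::perturb).
      n \<ge> 1 \<longrightarrow> 0 < \<eta> \<longrightarrow> \<eta> < 1 \<longrightarrow>
      (a, b) \<in> S_eta \<eta> \<longrightarrow>
      (\<forall>k. int n \<le> k \<longrightarrow> b k = 0) \<longrightarrow>
      outer_poly (lstar a) \<longrightarrow>
      finite {k. \<gamma> k \<noteq> 0} \<longrightarrow> nlft \<gamma> = (a, b) \<longrightarrow>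
      0 < \<epsilon> \<longrightarrow> (\<forall>k j i. cmod (d k j i) \<le> \<epsilon>) \<longrightarrow>
      real n ^ 3 * \<eta> powr (-5/2) * \<epsilon> \<le> c \<longrightarrow>
      l2norm (\<lambda>k. ext_seq (layer_strip_fl d n a b) k - \<gamma> k) / l2norm \<gamma>
        \<le> C * real n ^ 3 * \<eta> powr (-5/2) * \<epsilon>)"
  by (rule exI[of _ "1 / 16000"], rule exI[of _ 32000], intro conjI allI impI)
     (simp_all only: layer_strip_fl_error simp_thms zero_less_numeral zero_less_divide_1_iff)

end
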